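(* Let $K$ be a field of characteristic $0$ and let $d\geq 3$ be an integer. Let $\Delta=\{\nu\in\mathbb{N}^3:\nu_1+\nu_2+\nu_3=d\}$. For $q=(q_{i\nu})_{1\leq i\leq d+1,\ \nu\in\Delta}\in K^{(d+1)|\Delta|}$ put $f_i(q)=\sum_{\nu\in\Delta}q_{i\nu}\,x^{\nu_1}y^{\nu_2}z^{\nu_3}\in K[x,y,z]$ for $1\leq i\leq d+1$, and let $I(d,q)=(f_1(q),\ldots,f_{d+1}(q))\subset K[x,y,z]$. Then there is a nonempty Zariski-open set $U\subset K^{(d+1)|\Delta|}$ such that for every $q\in U$ the ideal $I(d,q)$ has at least $\frac{d}{3}$ distinct generic initial ideals; that is, the set $\{\operatorname{gin}_{\succ}(I(d,q)):\succ\text{ a term order on }K[x,y,z]\}$ has at least $\frac{d}{3}$ elements.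
   Context: Here $\mathbb{N}$ contains $0$. The polynomial ring $S=K[x,y,z]$ carries the standard grading. Each $g=(g_1,\ldots,g_9)\in \operatorname{GL}_3(K)$ acts on $S$ by the $K$-algebra automorphism $x\mapsto g_1x+g_2y+g_3z$, $y\mapsto g_4x+g_5y+g_6z$, $z\mapsto g_7x+g_8y+g_9z$. For a graded ideal $I\subset S$ and a term order $\succ$ on $S$ (any term order, with no restriction on how the variables are ordered), there is a nonempty Zariski-open set $V\subset \operatorname{GL}_3(K)$ such that the initial ideal $\operatorname{in}_{\succ}(g(I))$ is the same ideal for all $g\in V$; this ideal is the generic initial ideal $\operatorname{gin}_{\succ}(I)$. The generic initial ideals of $I$ are the ideals $\operatorname{gin}_{\succ}(I)$ as $\succ$ ranges over all term orders. *)

theory Defs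
  imports
    "HOL-Analysis.Cartesian_Space"
    "HOL-Library.Poly_Mapping"
    "HOL-Library.FuncSet"
    "HOL-Library.Numeral_Type"
begin

text \<open>
  Exponent vectors over a set of variables of type \<open>'v\<close> are finitely supported maps
  \<open>'v \<Rightarrow>\<^sub>0 nat\<close>; polynomials are finitely supported maps from exponent vectors to coefficients,
  with the convolution product of \<^theory>\<open>HOL-Library.Poly_Mapping\<close>.
\<close>

type_synonym 'v monom = "'v \<Rightarrow>\<^sub>0 nat"
type_synonym ('v, 'k) mpoly = "('v \<Rightarrow>\<^sub>0 nat) \<Rightarrow>\<^sub>0 'k"

text \<open>
  The ring \<open>K[x, y, z]\<close> is \<open>(3, 'k) mpoly\<close>; the variables \<open>x\<close>, \<open>y\<close>, \<open>z\<close> have the indices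
  \<open>1\<close>, \<open>2\<close>, \<open>3\<close> of the three-element type \<open>3\<close> (in which \<open>3 = 0\<close>).
\<close>

type_synonym 'k poly3 = "(3, 'k) mpoly"

abbreviation mconst :: "'k::comm_ring_1 \<Rightarrow> ('v, 'k) mpoly"
  where "mconst c \<equiv> Poly_Mapping.single 0 c"

abbreviation mvar :: "'v \<Rightarrow> ('v, 'k::comm_ring_1) mpoly"
  where "mvar v \<equiv> Poly_Mapping.single (Poly_Mapping.single v 1) 1"

global_interpretation ideal: module "(*) :: 'a::comm_ring_1 \<Rightarrow> 'a \<Rightarrow> 'a"
  defines ideal_generated = ideal.span
  by standard (simp_all add: algebra_simps)


section \<open>Zariski topology\<close>

definition mpoly_eval :: "('v \<Rightarrow> 'k) \<Rightarrow> ('v, 'k::comm_ring_1) mpoly \<Rightarrow> 'k"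
  where "mpoly_eval a p =
    (\<Sum>m\<in>Poly_Mapping.keys p.
       Poly_Mapping.lookup p m * (\<Prod>v\<in>Poly_Mapping.keys m. a v ^ Poly_Mapping.lookup m v))"

text \<open>
  For a finite index set \<open>X\<close>, the affine space \<open>K\<^sup>X\<close> is the set \<open>X \<rightarrow>\<^sub>E UNIV\<close> of functions that are
  undefined outside \<open>X\<close>. Its Zariski-closed sets are cut out by polynomials in the
  variables from \<open>X\<close> only.
\<close>

definition zariski_closed :: "'v set \<Rightarrow> ('v \<Rightarrow> 'k::field) set \<Rightarrow> bool"
  where "zariski_closed X Z \<longleftrightarrow>
    (\<exists>P :: ('v, 'k) mpoly set.
       (\<forall>p\<in>P. \<forall>m\<in>Poly_Mapping.keys p. Poly_Mapping.keys m \<subseteq> X) \<and>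
       Z = {a \<in> X \<rightarrow>\<^sub>E UNIV. \<forall>p\<in>P. mpoly_eval a p = 0})"

definition zariski_open :: "'v set \<Rightarrow> ('v \<Rightarrow> 'k::field) set \<Rightarrow> bool"
  where "zariski_open X U \<longleftrightarrow>
    U \<subseteq> (X \<rightarrow>\<^sub>E UNIV) \<and> zariski_closed X ((X \<rightarrow>\<^sub>E UNIV) - U)"

text \<open>\<open>GL\<^sub>3(K)\<close> carries the subspace topology from the affine space of all matrices.\<close>

definition zariski_open_GL3 :: "('k::field ^ 3 ^ 3) set \<Rightarrow> bool"
  where "zariski_open_GL3 V \<longleftrightarrow>
    (\<exists>W. zariski_open (UNIV :: (3 \<times> 3) set) W \<and>
         V = {g. invertible g \<and> (\<lambda>(i, j). g $ i $ j) \<in> W})"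


section \<open>Generic initial ideals\<close>

text \<open>
  \<open>(m, n) \<in> r\<close> means that \<open>m\<close> is smaller than or equal to \<open>n\<close>. In finitely many variables such an
  order is automatically a well-order.
\<close>

definition term_order :: "'v monom rel \<Rightarrow> bool"
  where "term_order r \<longleftrightarrow>
    linear_order r \<and> (\<forall>m. (0, m) \<in> r) \<and>
    (\<forall>l m n. (m, n) \<in> r \<longrightarrow> (m + l, n + l) \<in> r)"

definition initial_monom :: "'v monom rel \<Rightarrow> ('v, 'k::comm_ring_1) mpoly \<Rightarrow> 'v monom"
  where "initial_monom r p =
    (THE m. m \<in> Poly_Mapping.keys p \<and> (\<forall>n\<in>Poly_Mapping.keys p. (n, m) \<in> r))"

definition initial_ideal ::
    "'v monom rel \<Rightarrow> ('v, 'k::comm_ring_1) mpoly set \<Rightarrow> ('v, 'k) mpoly set"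
  where "initial_ideal r I =
    ideal_generated {Poly_Mapping.single (initial_monom r p) 1 |p. p \<in> I \<and> p \<noteq> 0}"

text \<open>The \<open>K\<close>-algebra endomorphism that sends the \<open>i\<close>-th variable to the linear form given by
  the \<open>i\<close>-th row of \<open>g\<close>.\<close>

definition GL3_act :: "'k::field ^ 3 ^ 3 \<Rightarrow> 'k poly3 \<Rightarrow> 'k poly3"
  where "GL3_act g p =
    (\<Sum>m\<in>Poly_Mapping.keys p. mconst (Poly_Mapping.lookup p m) *
       (\<Prod>i\<in>UNIV. (\<Sum>j\<in>UNIV. mconst (g $ i $ j) * mvar j) ^ Poly_Mapping.lookup m i))"

definition gin :: "3 monom rel \<Rightarrow> 'k::field poly3 set \<Rightarrow> 'k poly3 set"
  where "gin r I =
    (THE J. \<exists>V. zariski_open_GL3 V \<and> V \<noteq> {} \<and>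
       (\<forall>g\<in>V. initial_ideal r (GL3_act g ` I) = J))"


section \<open>Ideals generated by general forms\<close>

definition Delta :: "nat \<Rightarrow> 3 monom set"
  where "Delta d =
    {\<nu>. Poly_Mapping.lookup \<nu> 1 + Poly_Mapping.lookup \<nu> 2 + Poly_Mapping.lookup \<nu> 3 = d}"

definition form :: "nat \<Rightarrow> (nat \<times> 3 monom \<Rightarrow> 'k::field) \<Rightarrow> nat \<Rightarrow> 'k poly3"
  where "form d q i = (\<Sum>\<nu>\<in>Delta d. Poly_Mapping.single \<nu> (q (i, \<nu>)))"

definition form_ideal :: "nat \<Rightarrow> (nat \<times> 3 monom \<Rightarrow> 'k::field) \<Rightarrow> 'k poly3 set"
  where "form_ideal d q = ideal_generated (form d q ` {1..d + 1})"

end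

theory Submission
  imports Defs "HOL-Analysis.Determinants" "HOL-Computational_Algebra.Polynomial"
begin

text \<open>
  In degree \<open>d\<close> the generic initial ideal of \<open>d + 1\<close> general forms consists of the \<open>d + 1\<close> largest
  monomials. The term orders that refine the weights \<open>w, w - 2, 0\<close> with \<open>w = 4L - 2d + 1\<close> realise,
  for \<open>2d/3 \<le> L \<le> d\<close>, the set of all monomials with \<open>z\<close>-exponent \<open>0\<close> and \<open>y\<close>-exponent at most \<open>L\<close>
  or \<open>z\<close>-exponent \<open>1\<close> and \<open>y\<close>-exponent less than \<open>d - L\<close>; there are more than \<open>d/3\<close> such \<open>L\<close>.

  The leading monomials of a span of vectors that depend polynomially on a parameter are constant on
  a nonempty open set, by fraction-free Gaussian elimination, and an up-closed set of monomials that
  is leading at one point stays leading near it. Applied degree by degree to the coordinate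
  change \<open>g\<close> this shows that the generic initial ideal exists: for general \<open>q\<close> the ideal contains all
  monomials of degree \<open>3d\<close>, so only finitely many degrees matter.
\<close>

abbreviation lookup where "lookup \<equiv> Poly_Mapping.lookup"
abbreviation keys where "keys \<equiv> Poly_Mapping.keys"
abbreviation single where "single \<equiv> Poly_Mapping.single"

text \<open>This rule reassociates products to the left and makes \<open>algebra_simps\<close> loop.\<close>

declare ideal.scale_scale [simp del]

section \<open>Evaluation homomorphisms\<close>

lemma sum_single_lookup: "(\<Sum>m\<in>keys p. single m (lookup p m)) = p"
proof (rule poly_mapping_eqI)
  fix k
  have "lookup (\<Sum>m\<in>keys p. single m (lookup p m)) k =
      (\<Sum>m\<in>keys p. if m = k then lookup p m else 0)"
    by (simp only: lookup_sum lookup_single when_def)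
  also have "\<dots> = lookup p k"
    by (simp add: sum.delta in_keys_iff)
  finally show "lookup (\<Sum>m\<in>keys p. single m (lookup p m)) k = lookup p k" .
qed

text \<open>Serves polynomials, as sums of terms, and exponent vectors, as sums of multiples of unit
  vectors.\<close>

lemma poly_mapping_single_add_induct [case_names zero single add]:
  assumes "P 0" "\<And>m c. P (single m c)" "\<And>p q. P p \<Longrightarrow> P q \<Longrightarrow> P (p + q)"
  shows "P (p :: 'a \<Rightarrow>\<^sub>0 'b::comm_monoid_add)"
proof -
  have "P (\<Sum>m\<in>A. single m (lookup p m))" if "finite A" for A
    using that by (induction A rule: finite_induct) (auto intro: assms)
  from this[OF finite_keys[of p]] show ?thesis
    by (simp only: sum_single_lookup)
qed

text \<open>Evaluation at a point and linear substitution both sum \<open>h\<close> of a coefficient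
  times \<open>E\<close> of its monomial. With \<open>h\<close> a ring homomorphism and
  \<open>E\<close> multiplicative, such a map is a ring homomorphism; this is proved once for
  both.\<close>

locale evaluation =
  fixes h :: "'a::comm_ring_1 \<Rightarrow> 'r::comm_ring_1"
    and E :: "'m::comm_monoid_add \<Rightarrow> 'r"
  assumes h_0: "h 0 = 0" and h_1: "h 1 = 1" and h_add: "h (a + b) = h a + h b"
    and h_mult: "h (a * b) = h a * h b"
    and E_0: "E 0 = 1" and E_add: "E (m + n) = E m * E n"
begin

definition ev :: "('m \<Rightarrow>\<^sub>0 'a) \<Rightarrow> 'r"
  where "ev p = (\<Sum>m\<in>keys p. h (lookup p m) * E m)"

lemma ev_0: "ev 0 = 0"
  by (simp add: ev_def)

lemma ev_add: "ev (p + q) = ev p + ev q"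
  unfolding ev_def
  by (rule setsum_keys_plus_distrib) (simp_all add: h_0 h_add distrib_right)

lemma ev_single: "ev (single m c) = h c * E m"
  by (simp add: ev_def h_0)

lemma ev_sum: "ev (sum f A) = (\<Sum>a\<in>A. ev (f a))"
  by (induction A rule: infinite_finite_induct) (simp_all add: ev_0 ev_add)

lemma ev_mult: "ev (p * q) = ev p * ev q"
proof (induction p rule: poly_mapping_single_add_induct)
  case zero
  then show ?case by (simp add: ev_0)
next
  case (single m c)
  show ?case
  proof (induction q rule: poly_mapping_single_add_induct)
    case (single n d)
    show ?case
      by (simp only: ev_single mult_single h_mult E_add ac_simps)
  qed (simp_all add: ev_0 ev_add distrib_left)
next
  case (add p q)
  then show ?case by (simp add: ev_add distrib_right)
qed

lemma ev_1: "ev 1 = 1"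
  using ev_single[of 0 1] by (simp add: h_1 E_0)

end

section \<open>Evaluation at a point\<close>

lemma prod_keys_superset:
  assumes "finite A" "keys m \<subseteq> A"
  shows "(\<Prod>v\<in>keys m. a v ^ lookup m v) = (\<Prod>v\<in>A. a v ^ lookup m v :: 'k::comm_monoid_mult)"
  using assms by (intro prod.mono_neutral_left) (auto simp: in_keys_iff)

lemma evaluation_mpoly:
  fixes a :: "'v \<Rightarrow> 'k::comm_ring_1"
  shows "evaluation (\<lambda>c. c) (\<lambda>m. \<Prod>v\<in>keys m. a v ^ lookup m v)"
proof
  fix m n :: "'v monom"
  let ?A = "keys m \<union> keys n"
  show "(\<Prod>v\<in>keys (m + n). a v ^ lookup (m + n) v) =
      (\<Prod>v\<in>keys m. a v ^ lookup m v) * (\<Prod>v\<in>keys n. a v ^ lookup n v)"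
    using prod_keys_superset[of ?A m a] prod_keys_superset[of ?A n a]
      prod_keys_superset[of ?A "m + n" a] Poly_Mapping.keys_add[of m n]
    by (simp add: lookup_add power_add prod.distrib)
qed simp_all

lemma mpoly_eval_eq_ev: "mpoly_eval a p = evaluation.ev (\<lambda>c. c) (\<lambda>m. \<Prod>v\<in>keys m. a v ^ lookup m v) p"
  by (simp add: mpoly_eval_def evaluation.ev_def[OF evaluation_mpoly])

lemmas mpoly_eval_add = evaluation.ev_add[OF evaluation_mpoly, folded mpoly_eval_eq_ev]
  and mpoly_eval_mult = evaluation.ev_mult[OF evaluation_mpoly, folded mpoly_eval_eq_ev]
  and mpoly_eval_single = evaluation.ev_single[OF evaluation_mpoly, folded mpoly_eval_eq_ev]

section \<open>Linear substitution\<close>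

definition linear_subst :: "'k::field ^ 3 ^ 3 \<Rightarrow> 3 monom \<Rightarrow> 'k poly3"
  where "linear_subst g m =
    (\<Prod>i\<in>UNIV. (\<Sum>j\<in>UNIV. mconst (g $ i $ j) * mvar j) ^ lookup m i)"

lemma evaluation_GL3: "evaluation mconst (linear_subst (g :: 'a::field ^ 3 ^ 3))"
proof
  fix m n :: "3 monom" and a b :: 'a
  show "mconst (0 :: 'a) = (0 :: 'a poly3)" "mconst (1 :: 'a) = (1 :: 'a poly3)"
    by (rule single_zero single_one)+
  show "mconst (a + b) = (mconst a + mconst b :: 'a poly3)"
    by (rule single_add)
  show "mconst (a * b) = (mconst a * mconst b :: 'a poly3)"
    by (simp only: mult_single add_0)
  show "linear_subst g 0 = 1"
    by (simp only: linear_subst_def lookup_zero power_0 prod.neutral_const)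
  show "linear_subst g (m + n) = linear_subst g m * linear_subst g n"
    by (simp only: linear_subst_def lookup_add power_add prod.distrib)
qed

lemma GL3_act_eq_ev: "GL3_act g p = evaluation.ev mconst (linear_subst g) p"
  unfolding GL3_act_def evaluation.ev_def[OF evaluation_GL3] linear_subst_def ..

lemma GL3_act_0: "GL3_act g 0 = 0"
  and GL3_act_1: "GL3_act g 1 = 1"
  and GL3_act_add: "GL3_act g (p + q) = GL3_act g p + GL3_act g q"
  and GL3_act_sum: "GL3_act g (sum f A) = (\<Sum>a\<in>A. GL3_act g (f a))"
  and GL3_act_mult: "GL3_act g (p * q) = GL3_act g p * GL3_act g q"
  and GL3_act_single: "GL3_act g (single m c) = mconst c * linear_subst g m"
  by (simp_all only: GL3_act_eq_ev evaluation.ev_0[OF evaluation_GL3]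
      evaluation.ev_1[OF evaluation_GL3] evaluation.ev_add[OF evaluation_GL3]
      evaluation.ev_sum[OF evaluation_GL3] evaluation.ev_mult[OF evaluation_GL3]
      evaluation.ev_single[OF evaluation_GL3])

section \<open>Regular functions on affine space\<close>

text \<open>Speaking of functions instead of polynomials turns the regularity of determinants and of
  coefficients into closure properties.\<close>

definition regular :: "'v set \<Rightarrow> (('v \<Rightarrow> 'k::field) \<Rightarrow> 'k) \<Rightarrow> bool"
  where "regular X f \<longleftrightarrow>
    (\<exists>P :: ('v, 'k) mpoly. (\<forall>m\<in>keys P. keys m \<subseteq> X) \<and> f = (\<lambda>a. mpoly_eval a P))"

lemma regular_const: "regular X (\<lambda>_. c)"
  unfolding regular_def
  by (rule exI[of _ "single 0 c"]) (simp add: mpoly_eval_single)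

lemma regular_coord: "v \<in> X \<Longrightarrow> regular X (\<lambda>a. a v)"
  unfolding regular_def
  by (rule exI[of _ "mvar v"]) (simp add: mpoly_eval_single)

lemma regular_add:
  assumes "regular X f" "regular X g"
  shows "regular X (\<lambda>a. f a + g a)"
proof -
  obtain P Q where "\<forall>m\<in>keys P. keys m \<subseteq> X" "f = (\<lambda>a. mpoly_eval a P)"
    "\<forall>m\<in>keys Q. keys m \<subseteq> X" "g = (\<lambda>a. mpoly_eval a Q)"
    using assms unfolding regular_def by blast
  then show ?thesis
    unfolding regular_def using Poly_Mapping.keys_add[of P Q]
    by (intro exI[of _ "P + Q"]) (auto simp: mpoly_eval_add)
qed

lemma regular_mult:
  assumes "regular X f" "regular X g"
  shows "regular X (\<lambda>a. f a * g a)"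
proof -
  obtain P Q where PQ: "\<forall>m\<in>keys P. keys m \<subseteq> X" "f = (\<lambda>a. mpoly_eval a P)"
    "\<forall>m\<in>keys Q. keys m \<subseteq> X" "g = (\<lambda>a. mpoly_eval a Q)"
    using assms unfolding regular_def by blast
  have "keys m \<subseteq> X" if m: "m \<in> keys (P * Q)" for m
  proof -
    obtain a b where ab: "a \<in> keys P" "b \<in> keys Q" "m = a + b"
      using m Poly_Mapping.keys_mult[of P Q] by blast
    then show ?thesis
      using PQ Poly_Mapping.keys_add[of a b] by blast
  qed
  then show ?thesis
    unfolding regular_def using PQ
    by (intro exI[of _ "P * Q"]) (auto simp: mpoly_eval_mult)
qed

lemma regular_diff:
  assumes "regular X f" "regular X g"
  shows "regular X (\<lambda>a. f a - g a)"
  using regular_add[OF assms(1) regular_mult[OF regular_const[of X "-1"] assms(2)]] by simp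

lemma regular_sum: "(\<And>i. i \<in> A \<Longrightarrow> regular X (f i)) \<Longrightarrow> regular X (\<lambda>a. \<Sum>i\<in>A. f i a)"
  by (induction A rule: infinite_finite_induct) (auto intro: regular_const regular_add)

lemma regular_prod: "(\<And>i. i \<in> A \<Longrightarrow> regular X (f i)) \<Longrightarrow> regular X (\<lambda>a. \<Prod>i\<in>A. f i a)"
  by (induction A rule: infinite_finite_induct) (auto intro: regular_const regular_mult)

text \<open>Substituting linear polynomials in \<open>t\<close> for the coordinates reduces
  nonvanishing to univariate polynomials.\<close>

lemma regular_poly_on_line:
  assumes "regular X f"
  shows "\<exists>u. \<forall>t. f (\<lambda>v. a v + t * (b v - a v)) = poly u t"
proof -
  obtain P where P: "f = (\<lambda>a. mpoly_eval a P)"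
    using assms unfolding regular_def by blast
  define u where "u = (\<Sum>m\<in>keys P. [:lookup P m:] * (\<Prod>v\<in>keys m. [:a v, b v - a v:] ^ lookup m v))"
  have "f (\<lambda>v. a v + t * (b v - a v)) = poly u t" for t
    by (simp add: u_def P mpoly_eval_def poly_sum poly_prod)
  then show ?thesis by blast
qed

text \<open>Nonempty principal open sets, represented by their equations: finite intersections
  become products.\<close>

definition regular_nz :: "'v set \<Rightarrow> (('v \<Rightarrow> 'k::field) \<Rightarrow> 'k) \<Rightarrow> bool"
  where "regular_nz X f \<longleftrightarrow> regular X f \<and> (\<exists>a \<in> X \<rightarrow>\<^sub>E UNIV. f a \<noteq> 0)"

text \<open>Irreducibility of affine space: on the line through two points at which the factors do not
  vanish, each factor is a nonzero univariate polynomial.\<close>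

lemma regular_nz_mult:
  fixes f g :: "('v \<Rightarrow> 'k::field_char_0) \<Rightarrow> 'k"
  assumes "regular_nz X f" "regular_nz X g"
  shows "regular_nz X (\<lambda>a. f a * g a)"
proof -
  obtain a b where a: "a \<in> X \<rightarrow>\<^sub>E UNIV" "f a \<noteq> 0" and b: "b \<in> X \<rightarrow>\<^sub>E UNIV" "g b \<noteq> 0"
    using assms unfolding regular_nz_def by blast
  define l where "l t = (\<lambda>v. a v + t * (b v - a v))" for t
  obtain u w where u: "\<And>t. f (l t) = poly u t" and w: "\<And>t. g (l t) = poly w t"
    using regular_poly_on_line[of X f a b] regular_poly_on_line[of X g a b] assms
    unfolding l_def regular_nz_def by auto
  have "u \<noteq> 0"
    using u[of 0] a by (auto simp: l_def)
  moreover have "w \<noteq> 0"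
    using w[of 1] b by (auto simp: l_def)
  ultimately have "finite {t. poly (u * w) t = 0}"
    by (intro poly_roots_finite) simp
  \<comment> \<open>Characteristic zero makes the field infinite, so finitely many roots leave some
    \<open>t\<close> over.\<close>
  then have "{t. poly (u * w) t = 0} \<noteq> UNIV"
    using infinite_UNIV_char_0[where 'a = 'k] by metis
  then obtain t where t: "poly (u * w) t \<noteq> 0"
    by blast
  \<comment> \<open>Outside \<open>X\<close> both \<open>a\<close> and \<open>b\<close> equal
    \<open>undefined\<close>, so their difference is 0 and the line stays extensional.\<close>
  have "l t \<in> X \<rightarrow>\<^sub>E UNIV"
    using a b by (auto simp: l_def PiE_def extensional_def)
  then show ?thesis
    using assms t unfolding regular_nz_def by (intro conjI regular_mult bexI[of _ "l t"]) (auto simp: u w)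
qed

lemma regular_nz_prod:
  fixes f :: "'i \<Rightarrow> ('v \<Rightarrow> 'k::field_char_0) \<Rightarrow> 'k"
  shows "(\<And>i. i \<in> A \<Longrightarrow> regular_nz X (f i)) \<Longrightarrow> regular_nz X (\<lambda>a. \<Prod>i\<in>A. f i a)"
proof (induction A rule: infinite_finite_induct)
  case (insert i A)
  then show ?case by (simp add: regular_nz_mult)
qed (auto simp: regular_nz_def regular_const PiE_eq_empty_iff ex_in_conv)

lemma zariski_open_nonvanishing:
  assumes "regular X f"
  shows "zariski_open X {a \<in> X \<rightarrow>\<^sub>E UNIV. f a \<noteq> 0}"
proof -
  obtain P where P: "\<forall>m\<in>keys P. keys m \<subseteq> X" "f = (\<lambda>a. mpoly_eval a P)"
    using assms unfolding regular_def by blast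
  then show ?thesis
    unfolding zariski_open_def zariski_closed_def by (intro conjI exI[of _ "{P}"]) auto
qed

text \<open>Principal open sets form a basis: one of the equations of the complement fails at
  \<open>a\<close>.\<close>

lemma zariski_open_contains_nonvanishing:
  assumes "zariski_open X U" "a \<in> U"
  shows "\<exists>f. regular X f \<and> f a \<noteq> 0 \<and> {b \<in> X \<rightarrow>\<^sub>E UNIV. f b \<noteq> 0} \<subseteq> U"
proof -
  obtain Ps where Ps: "\<forall>p\<in>Ps. \<forall>m\<in>keys p. keys m \<subseteq> X"
    "(X \<rightarrow>\<^sub>E UNIV) - U = {a \<in> X \<rightarrow>\<^sub>E UNIV. \<forall>p\<in>Ps. mpoly_eval a p = 0}" and U: "U \<subseteq> X \<rightarrow>\<^sub>E UNIV"
    using assms unfolding zariski_open_def zariski_closed_def by blast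
  then obtain p where "p \<in> Ps" "mpoly_eval a p \<noteq> 0"
    using assms(2) by blast
  then show ?thesis
    using Ps unfolding regular_def by (intro exI[of _ "\<lambda>a. mpoly_eval a p"] conjI exI[of _ p]) auto
qed

section \<open>Leading positions of a family of vectors\<close>

lemma linear_order_antisym: "linear_order r \<Longrightarrow> (a, b) \<in> r \<Longrightarrow> (b, a) \<in> r \<Longrightarrow> a = b"
  by (auto simp: order_on_defs dest: antisymD)

lemma linear_order_refl: "linear_order r \<Longrightarrow> (a, a) \<in> r"
  by (auto simp: order_on_defs dest: refl_onD)

lemma linear_order_trans: "linear_order r \<Longrightarrow> (a, b) \<in> r \<Longrightarrow> (b, c) \<in> r \<Longrightarrow> (a, c) \<in> r"
  by (auto simp: order_on_defs dest: transD)

lemma linear_order_linear: "linear_order r \<Longrightarrow> (a, b) \<in> r \<or> (b, a) \<in> r"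
  using linear_order_refl[of r a] by (cases "a = b") (auto simp: order_on_defs total_on_def)

lemma linear_order_finite_max:
  assumes "linear_order r" "finite S" "S \<noteq> {}"
  shows "\<exists>t\<in>S. \<forall>s\<in>S. (s, t) \<in> r"
  using assms(2,3)
proof (induction S rule: finite_ne_induct)
  case (singleton x)
  then show ?case using linear_order_refl[OF assms(1)] by simp
next
  case (insert x S)
  then obtain t where t: "t \<in> S" "\<forall>s\<in>S. (s, t) \<in> r" by blast
  show ?case
  proof (cases "(x, t) \<in> r")
    case True
    then show ?thesis using t by blast
  next
    case False
    then have "(t, x) \<in> r" using linear_order_linear[OF assms(1)] by blast
    then show ?thesis
      using t linear_order_trans[OF assms(1)] linear_order_refl[OF assms(1)] by blast
  qed
qed

text \<open>Each step adds a new maximum. In the elimination below this means that the largest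
  column is cleared first.\<close>

lemma linear_order_max_induct [consumes 2, case_names empty insert]:
  assumes "linear_order r" "finite S"
    and "P {}"
    and step: "\<And>S t. finite S \<Longrightarrow> t \<notin> S \<Longrightarrow> \<forall>s\<in>S. (s, t) \<in> r \<Longrightarrow> P S \<Longrightarrow> P (insert t S)"
  shows "P S"
  using assms(2)
proof (induction S rule: finite_remove_induct)
  case empty
  then show ?case using assms(3) .
next
  case (remove S)
  then obtain t where t: "t \<in> S" "\<forall>s\<in>S. (s, t) \<in> r"
    using linear_order_finite_max[OF assms(1)] by blast
  then have "P (insert t (S - {t}))"
    using remove by (intro step) auto
  then show ?case using t by (simp add: insert_absorb)
qed

text \<open>For the matrix with rows \<open>V i\<close> and columns \<open>S\<close>, sorted from
  the largest column down, these are the pivot columns of the row space.\<close>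

definition leads :: "'u rel \<Rightarrow> 'u set \<Rightarrow> 'i set \<Rightarrow> ('i \<Rightarrow> 'u \<Rightarrow> 'k::field) \<Rightarrow> 'u set"
  where "leads r S A V =
    {u \<in> S. \<exists>c. (\<Sum>i\<in>A. c i * V i u) \<noteq> 0 \<and> (\<forall>s\<in>S. (\<Sum>i\<in>A. c i * V i s) \<noteq> 0 \<longrightarrow> (s, u) \<in> r)}"

text \<open>Row reduction without division, so that entries depending polynomially on a parameter
  still do so afterwards. Row \<open>j\<close> itself becomes 0.\<close>

definition eliminate :: "'u \<Rightarrow> 'i \<Rightarrow> ('i \<Rightarrow> 'u \<Rightarrow> 'k::field) \<Rightarrow> 'i \<Rightarrow> 'u \<Rightarrow> 'k"
  where "eliminate t j V i u = V j t * V i u - V i t * V j u"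

lemma leads_subset: "leads r S A V \<subseteq> S"
  by (auto simp: leads_def)

lemma leads_insert_zero:
  assumes "\<And>i. i \<in> A \<Longrightarrow> V i t = 0"
  shows "leads r (insert t S) A V = leads r S A V"
proof -
  have "(\<Sum>i\<in>A. c i * V i t) = 0" for c
    using assms by simp
  then show ?thesis
    unfolding leads_def by auto
qed

text \<open>One step of Gaussian elimination. The largest column \<open>t\<close> is a pivot; every
  other pivot comes from a combination of rows vanishing at \<open>t\<close>, and those are, up to a
  nonzero factor, the combinations of the eliminated rows.\<close>

lemma leads_insert_pivot:
  assumes r: "linear_order r" and t: "t \<notin> S" "\<forall>s\<in>S. (s, t) \<in> r"
    and A: "finite A" "j \<in> A" and pivot: "V j t \<noteq> 0"
  shows "leads r (insert t S) A V = insert t (leads r S (A - {j}) (eliminate t j V))"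
proof -
  let ?e = "\<lambda>c u. \<Sum>i\<in>A. c i * V i u"
  let ?e' = "\<lambda>c u. \<Sum>i\<in>A - {j}. c i * eliminate t j V i u"
  have max: "\<forall>s\<in>insert t S. (s, t) \<in> r"
    using t linear_order_refl[OF r] by blast
  \<comment> \<open>Row \<open>j\<close> may be kept in the sum, since it is eliminated to 0; then
    the formula follows by linearity.\<close>
  have e': "?e' c u = V j t * ?e c u - ?e c t * V j u" for c u
  proof -
    have "eliminate t j V j u = 0"
      unfolding eliminate_def by (rule diff_self)
    then have "?e' c u = (\<Sum>i\<in>A. c i * eliminate t j V i u)"
      by (simp only: sum.remove[OF A] mult_zero_right add_0_left)
    also have "\<dots> = (\<Sum>i\<in>A. V j t * (c i * V i u) - (c i * V i t) * V j u)"
      by (intro sum.cong refl) (simp add: eliminate_def right_diff_distrib mult.left_commute mult.assoc)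
    finally show ?thesis
      by (simp only: sum_subtractf sum_distrib_left sum_distrib_right)
  qed
  have ind: "(\<Sum>i\<in>A. of_bool (i = j) * V i s) = V j s" for s
    unfolding sum.remove[OF A] by (simp add: sum.neutral)
  have t_lead: "t \<in> leads r (insert t S) A V"
  proof -
    have "?e (\<lambda>i. of_bool (i = j)) t \<noteq> 0"
      unfolding ind by (rule pivot)
    then show ?thesis
      unfolding leads_def using max by (intro CollectI conjI insertI1 exI) auto
  qed
  have "u \<in> leads r S (A - {j}) (eliminate t j V)"
    if u: "u \<in> leads r (insert t S) A V" "u \<noteq> t" for u
  proof -
    obtain c where c: "?e c u \<noteq> 0" "\<forall>s\<in>insert t S. ?e c s \<noteq> 0 \<longrightarrow> (s, u) \<in> r" and "u \<in> S"
      using u unfolding leads_def by blast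
    \<comment> \<open>Otherwise \<open>t\<close> would lie below \<open>u\<close>, while
      \<open>t\<close> is the maximum and differs from \<open>u\<close>.\<close>
    then have "?e c t = 0"
      using max u(2) linear_order_antisym[OF r, of t u] by blast
    then have "?e' c s \<noteq> 0 \<longleftrightarrow> ?e c s \<noteq> 0" for s
      using pivot by (simp only: e' mult_zero_left diff_zero mult_eq_0_iff) simp
    then show ?thesis
      unfolding leads_def using c(2) \<open>u \<in> S\<close>
      by (intro CollectI conjI exI[of _ c]) (use c in blast)+
  qed
  moreover have "u \<in> leads r (insert t S) A V"
    if u: "u \<in> leads r S (A - {j}) (eliminate t j V)" for u
  proof -
    obtain c where c: "?e' c u \<noteq> 0" "\<forall>s\<in>S. ?e' c s \<noteq> 0 \<longrightarrow> (s, u) \<in> r" and "u \<in> S"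
      using u unfolding leads_def by blast
    \<comment> \<open>The coefficients \<open>b\<close> write the eliminated combination in terms of
      the original rows: scale by the pivot, then subtract \<open>y\<close> times row
      \<open>j\<close>.\<close>
    define y where "y = ?e c t"
    define b where "b i = V j t * c i - of_bool (i = j) * y" for i
    have b: "?e b s = ?e' c s" for s
    proof -
      have "?e b s = (\<Sum>i\<in>A. V j t * (c i * V i s) - y * (of_bool (i = j) * V i s))"
        unfolding b_def
        by (intro sum.cong refl) (simp add: left_diff_distrib mult.left_commute mult.assoc)
      also have "\<dots> = V j t * ?e c s - y * (\<Sum>i\<in>A. of_bool (i = j) * V i s)"
        by (simp only: sum_subtractf sum_distrib_left)
      finally show ?thesis
        by (simp only: ind e' y_def)
    qed
    have "?e b t = 0"
      by (simp only: b e' mult.commute[of "V j t"] diff_self)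
    then have "\<forall>s\<in>insert t S. ?e b s \<noteq> 0 \<longrightarrow> (s, u) \<in> r"
      using c(2) b by (metis insert_iff)
    moreover have "?e b u \<noteq> 0"
      using c(1) b by metis
    ultimately show ?thesis
      unfolding leads_def using \<open>u \<in> S\<close> by blast
  qed
  ultimately show ?thesis
    using t_lead by blast
qed

text \<open>Each pivot uses up one row.\<close>

lemma card_leads_le:
  assumes "linear_order r" "finite S" "finite A"
  shows "card (leads r S A V) \<le> card A"
  using assms
proof (induction arbitrary: A V rule: linear_order_max_induct)
  case empty
  then show ?case by (simp add: leads_def)
next
  case (insert S t)
  show ?case
  proof (cases "\<exists>j\<in>A. V j t \<noteq> 0")
    case True
    then obtain j where j: "j \<in> A" "V j t \<noteq> 0" by blast
    let ?L = "leads r S (A - {j}) (eliminate t j V)"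
    have "finite ?L"
      using leads_subset insert(1) by (rule finite_subset)
    then have "card (insert t ?L) \<le> Suc (card ?L)"
      by (simp add: card_insert_if)
    moreover have "card ?L \<le> card (A - {j})"
      using insert by simp
    ultimately have "card (insert t ?L) \<le> Suc (card (A - {j}))"
      by linarith
    then show ?thesis
      unfolding leads_insert_pivot[where V = V, OF assms(1) insert(2,3) insert.prems j]
      using card_Suc_Diff1[OF insert.prems j(1)] by linarith
  next
    case False
    then show ?thesis
      using leads_insert_zero[of A V t r S] insert.IH[OF insert.prems, of V] by simp
  qed
qed

lemma regular_eliminate:
  assumes "\<And>i. i \<in> A \<Longrightarrow> \<forall>u\<in>insert t S. regular X (\<lambda>a. F i a u)" "j \<in> A" "i \<in> A" "u \<in> S"
  shows "regular X (\<lambda>a. eliminate t j (\<lambda>i. F i a) i u)"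
  unfolding eliminate_def using assms by (intro regular_diff regular_mult) auto

text \<open>All parameters are eliminated at once. If some entry of the largest column is not
  identically 0 on the affine space, it is the pivot wherever it does not vanish; otherwise the
  column is dropped. The product of the pivots is \<open>f\<close>.\<close>

lemma generic_leads:
  fixes F :: "'i \<Rightarrow> ('v \<Rightarrow> 'k::field_char_0) \<Rightarrow> 'u \<Rightarrow> 'k"
  assumes "linear_order r" "finite S" "finite A"
    and "\<And>i. i \<in> A \<Longrightarrow> \<forall>u\<in>S. regular X (\<lambda>a. F i a u)"
  shows "\<exists>f B. regular_nz X f \<and>
    (\<forall>a \<in> X \<rightarrow>\<^sub>E UNIV. f a \<noteq> 0 \<longrightarrow> leads r S A (\<lambda>i. F i a) = B)"
  using assms
proof (induction arbitrary: A F rule: linear_order_max_induct)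
  case empty
  have "regular_nz X (\<lambda>_. 1 :: 'k)"
    using regular_nz_prod[of "{}" X "\<lambda>_ _. 1 :: 'k"] by simp
  then show ?case
    by (intro exI[of _ "\<lambda>_. 1"] exI[of _ "{}"]) (simp add: leads_def)
next
  case (insert S t)
  show ?case
  proof (cases "\<exists>j\<in>A. \<exists>a \<in> X \<rightarrow>\<^sub>E UNIV. F j a t \<noteq> 0")
    case True
    then obtain j where j: "j \<in> A" "\<exists>a \<in> X \<rightarrow>\<^sub>E UNIV. F j a t \<noteq> 0" by blast
    have "regular_nz X (\<lambda>a. F j a t)"
      using j insert.prems(2) by (auto simp: regular_nz_def)
    moreover have "\<exists>f B. regular_nz X f \<and> (\<forall>a \<in> X \<rightarrow>\<^sub>E UNIV. f a \<noteq> 0 \<longrightarrow>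
        leads r S (A - {j}) (eliminate t j (\<lambda>i. F i a)) = B)"
    proof (rule insert.IH[where F = "\<lambda>i a. eliminate t j (\<lambda>i. F i a) i"])
      show "finite (A - {j})" using insert.prems(1) by simp
      show "\<forall>u\<in>S. regular X (\<lambda>a. eliminate t j (\<lambda>i. F i a) i u)" if "i \<in> A - {j}" for i
        using regular_eliminate[OF insert.prems(2) j(1)] that by simp
    qed
    then obtain f B where f: "regular_nz X f" and B: "\<forall>a \<in> X \<rightarrow>\<^sub>E UNIV. f a \<noteq> 0 \<longrightarrow>
        leads r S (A - {j}) (eliminate t j (\<lambda>i. F i a)) = B"
      by (elim exE conjE)
    ultimately have "regular_nz X (\<lambda>a. F j a t * f a)"
      by (intro regular_nz_mult)
    moreover have "leads r (insert t S) A (\<lambda>i. F i a) = insert t B"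
      if "a \<in> X \<rightarrow>\<^sub>E UNIV" "F j a t * f a \<noteq> 0" for a
      using leads_insert_pivot[OF assms(1) insert(2,3) insert.prems(1) j(1), of "\<lambda>i. F i a"]
        B that by simp
    ultimately show ?thesis
      by (intro exI[of _ "\<lambda>a. F j a t * f a"] exI[of _ "insert t B"] conjI ballI impI)
  next
    case False
    have "\<exists>f B. regular_nz X f \<and> (\<forall>a \<in> X \<rightarrow>\<^sub>E UNIV. f a \<noteq> 0 \<longrightarrow> leads r S A (\<lambda>i. F i a) = B)"
      using insert.prems by (intro insert.IH) simp_all
    then obtain f B where f: "regular_nz X f" and B: "\<forall>a \<in> X \<rightarrow>\<^sub>E UNIV. f a \<noteq> 0 \<longrightarrow>
        leads r S A (\<lambda>i. F i a) = B"
      by (elim exE conjE)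
    have "leads r (insert t S) A (\<lambda>i. F i a) = B" if "a \<in> X \<rightarrow>\<^sub>E UNIV" "f a \<noteq> 0" for a
      using leads_insert_zero[of A "\<lambda>i. F i a" t r S] False B that by simp
    with f show ?thesis
      by (intro exI[of _ f] exI[of _ B] conjI ballI impI)
  qed
qed

text \<open>For an up-closed \<open>T\<close>, the columns in \<open>T\<close> come first in the
  elimination and all of them have pivots at \<open>b\<close>. The product of these pivots, chosen
  nonzero at \<open>b\<close>, is \<open>f\<close>.\<close>

lemma leads_semicontinuous:
  fixes F :: "'i \<Rightarrow> ('v \<Rightarrow> 'k::field) \<Rightarrow> 'u \<Rightarrow> 'k"
  assumes "linear_order r" "finite S" "finite A"
    and "\<And>i. i \<in> A \<Longrightarrow> \<forall>u\<in>S. regular X (\<lambda>a. F i a u)"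
    and "T \<subseteq> leads r S A (\<lambda>i. F i b)"
    and "\<And>s t. t \<in> T \<Longrightarrow> s \<in> S \<Longrightarrow> (t, s) \<in> r \<Longrightarrow> s \<in> T"
  shows "\<exists>f. regular X f \<and> f b \<noteq> 0 \<and> (\<forall>a. f a \<noteq> 0 \<longrightarrow> T \<subseteq> leads r S A (\<lambda>i. F i a))"
  using assms
proof (induction arbitrary: A F T rule: linear_order_max_induct)
  case empty
  then have "T = {}" by (auto simp: leads_def)
  then show ?case
    by (intro exI[of _ "\<lambda>_. 1"]) (simp add: regular_const)
next
  case (insert S t)
  show ?case
  proof (cases "T = {}")
    case True
    then show ?thesis
      by (intro exI[of _ "\<lambda>_. 1"]) (simp add: regular_const)
  next
    case False
    have max: "\<forall>s\<in>insert t S. (s, t) \<in> r"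
      using insert(3) linear_order_refl[OF assms(1)] by blast
    \<comment> \<open>An up-closed nonempty \<open>T\<close> contains the maximum \<open>t\<close>.
      So \<open>t\<close> leads at \<open>b\<close>, and some row is nonzero there.\<close>
    obtain x where x: "x \<in> T"
      using False by blast
    then have "x \<in> insert t S"
      by (rule subsetD[OF order_trans[OF insert.prems(3) leads_subset]])
    with x have "t \<in> T"
      using insert.prems(4)[of x t] max by simp
    then have "t \<in> leads r (insert t S) A (\<lambda>i. F i b)"
      using insert.prems(3) by blast
    then obtain c where "(\<Sum>i\<in>A. c i * F i b t) \<noteq> 0"
      unfolding leads_def by blast
    then obtain j where "j \<in> A" "c j * F j b t \<noteq> 0"
      by (rule sum.not_neutral_contains_not_neutral)
    then have j: "j \<in> A" "F j b t \<noteq> 0"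
      by simp_all
    have pivot: "leads r (insert t S) A (\<lambda>i. F i a) =
        insert t (leads r S (A - {j}) (eliminate t j (\<lambda>i. F i a)))" if "F j a t \<noteq> 0" for a
      using leads_insert_pivot[OF assms(1) insert(2,3) insert.prems(1) j(1), of "\<lambda>i. F i a"] that .
    have "\<exists>f. regular X f \<and> f b \<noteq> 0 \<and> (\<forall>a. f a \<noteq> 0 \<longrightarrow>
        T - {t} \<subseteq> leads r S (A - {j}) (eliminate t j (\<lambda>i. F i a)))"
    proof (rule insert.IH[where F = "\<lambda>i a. eliminate t j (\<lambda>i. F i a) i"])
      show "T - {t} \<subseteq> leads r S (A - {j}) (eliminate t j (\<lambda>i. F i b))"
        using insert.prems(3) pivot[OF j(2)] by auto
    qed (use insert.prems(1,4) insert(2) regular_eliminate[OF insert.prems(2) j(1)] in auto)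
    then obtain f where f: "regular X f" "f b \<noteq> 0"
      "\<forall>a. f a \<noteq> 0 \<longrightarrow> T - {t} \<subseteq> leads r S (A - {j}) (eliminate t j (\<lambda>i. F i a))"
      by (elim exE conjE)
    have "regular X (\<lambda>a. F j a t * f a)"
      using insert.prems(2)[OF j(1)] f by (intro regular_mult) auto
    moreover have "T \<subseteq> leads r (insert t S) A (\<lambda>i. F i a)" if "F j a t * f a \<noteq> 0" for a
      using f(3) pivot[of a] that by auto
    ultimately show ?thesis
      using f j by (intro exI[of _ "\<lambda>a. F j a t * f a"]) auto
  qed
qed

section \<open>Forms and changes of coordinates\<close>

definition tdeg :: "3 monom \<Rightarrow> nat"
  where "tdeg m = lookup m 1 + lookup m 2 + lookup m 3"

lemma Delta_eq: "Delta n = {m. tdeg m = n}"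
  by (simp add: Delta_def tdeg_def)

lemma tdeg_0 [simp]: "tdeg 0 = 0"
  by (simp add: tdeg_def)

lemma tdeg_add: "tdeg (m + n) = tdeg m + tdeg n"
  by (simp add: tdeg_def lookup_add)

lemma tdeg_single: "tdeg (single i k) = k"
  using exhaust_3[of i] by (auto simp: tdeg_def lookup_single)

lemma monom3_eqI:
  "lookup m 1 = lookup n 1 \<Longrightarrow> lookup m 2 = lookup n 2 \<Longrightarrow> lookup m 3 = lookup n 3 \<Longrightarrow> m = (n :: 3 monom)"
  by (rule poly_mapping_eqI) (metis exhaust_3)

lemma finite_Delta: "finite (Delta n)"
proof (rule finite_imageD)
  let ?f = "\<lambda>m :: 3 monom. (lookup m 1, lookup m 2, lookup m 3)"
  have "?f ` Delta n \<subseteq> {..n} \<times> {..n} \<times> {..n}"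
    by (auto simp: Delta_def)
  then show "finite (?f ` Delta n)"
    by (rule finite_subset) simp
  show "inj_on ?f (Delta n)"
    by (auto intro!: inj_onI monom3_eqI)
qed

text \<open>Dropping one variable at a time reaches degree exactly \<open>N\<close>. Hence if all
  monomials of degree \<open>N\<close> lead, so do all of higher degree.\<close>

lemma tdeg_split:
  assumes "N \<le> tdeg m"
  shows "\<exists>u v. m = u + v \<and> tdeg u = N"
  using assms
proof (induction "tdeg m - N" arbitrary: m)
  case 0
  then show ?case by (intro exI[of _ m] exI[of _ 0]) simp
next
  case (Suc k)
  then have "tdeg m \<noteq> 0" by linarith
  then have "m \<noteq> 0" by (metis tdeg_0)
  then obtain i where i: "lookup m i \<noteq> 0"
    by (metis lookup_zero poly_mapping_eqI)
  define n where "n = m - single i 1"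
  have m: "m = n + single i 1"
    using i by (intro poly_mapping_eqI) (auto simp: n_def lookup_add lookup_minus lookup_single when_def)
  then have "tdeg m = Suc (tdeg n)"
    by (simp add: tdeg_add tdeg_single)
  then obtain u v where "n = u + v" "tdeg u = N"
    using Suc(1)[of n] Suc(2,3) by (metis Suc_diff_le Suc_inject diff_Suc_Suc diff_is_0_eq nat.distinct(1) not_less_eq_eq)
  then show ?case
    using m by (intro exI[of _ u] exI[of _ "v + single i 1"]) (simp add: add.assoc)
qed

section \<open>Homogeneity under linear substitution\<close>

definition homogeneous :: "nat \<Rightarrow> 'k::comm_ring_1 poly3 \<Rightarrow> bool"
  where "homogeneous n p \<longleftrightarrow> keys p \<subseteq> Delta n"

lemma homogeneous_single: "tdeg m = n \<Longrightarrow> homogeneous n (single m c)"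
  by (simp add: homogeneous_def Delta_eq)

lemma homogeneous_add: "homogeneous n p \<Longrightarrow> homogeneous n q \<Longrightarrow> homogeneous n (p + q)"
  using Poly_Mapping.keys_add[of p q] by (auto simp: homogeneous_def)

lemma homogeneous_sum: "(\<And>i. i \<in> A \<Longrightarrow> homogeneous n (f i)) \<Longrightarrow> homogeneous n (sum f A)"
  by (induction A rule: infinite_finite_induct) (auto simp: homogeneous_add, auto simp: homogeneous_def)

lemma homogeneous_mult: "homogeneous m p \<Longrightarrow> homogeneous n q \<Longrightarrow> homogeneous (m + n) (p * q)"
  using Poly_Mapping.keys_mult[of p q] by (fastforce simp: homogeneous_def Delta_eq tdeg_add)

lemma homogeneous_1: "homogeneous 0 1"
  by (simp add: homogeneous_def Delta_eq)

lemma homogeneous_power: "homogeneous 1 p \<Longrightarrow> homogeneous k (p ^ k)"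
  using homogeneous_mult[of 1 p] by (induction k) (auto simp: homogeneous_1)

lemma prod_UNIV_3: "(\<Prod>i\<in>UNIV. f (i :: 3)) = f 1 * (f 2 * f 3)"
  unfolding UNIV_3 by simp

lemma homogeneous_linear_subst: "homogeneous (tdeg m) (linear_subst g m)"
proof -
  have "homogeneous (0 + 1) (mconst (g $ i $ j) * mvar j)" for i j
    by (intro homogeneous_mult homogeneous_single) (simp_all add: tdeg_single)
  then have lin: "homogeneous 1 (\<Sum>j\<in>UNIV. mconst (g $ i $ j) * mvar j)" for i
    by (intro homogeneous_sum) simp
  have "homogeneous (lookup m 1 + (lookup m 2 + lookup m 3)) (linear_subst g m)"
    unfolding linear_subst_def prod_UNIV_3
    by (intro homogeneous_mult homogeneous_power lin)
  then show ?thesis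
    by (simp add: tdeg_def add.assoc)
qed

lemma GL3_act_eq_sum: "GL3_act g p = (\<Sum>m\<in>keys p. mconst (lookup p m) * linear_subst g m)"
  by (simp add: GL3_act_def linear_subst_def)

lemma homogeneous_GL3_act:
  assumes "homogeneous n p"
  shows "homogeneous n (GL3_act g p)"
  unfolding GL3_act_eq_sum
proof (rule homogeneous_sum)
  fix m assume "m \<in> keys p"
  then have "tdeg m = n"
    using assms by (auto simp: homogeneous_def Delta_eq)
  then show "homogeneous n (mconst (lookup p m) * linear_subst g m)"
    using homogeneous_mult[OF homogeneous_single[OF tdeg_0, of "lookup p m"]
        homogeneous_linear_subst[of m g]] by simp
qed

lemma linear_subst_var: "linear_subst g (single i 1) = (\<Sum>j\<in>UNIV. mconst (g $ i $ j) * mvar j)"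
proof -
  have "linear_subst g (single i 1) =
      (\<Prod>k\<in>UNIV. if k = i then (\<Sum>j\<in>UNIV. mconst (g $ k $ j) * mvar j) else 1)"
    unfolding linear_subst_def by (intro prod.cong refl) (auto simp: lookup_single)
  then show ?thesis by (simp add: prod.delta)
qed

lemma GL3_act_mvar: "GL3_act g (mvar i) = (\<Sum>j\<in>UNIV. mconst (g $ i $ j) * mvar j)"
  by (simp only: GL3_act_single linear_subst_var single_one mult_1)

lemma GL3_act_mconst: "GL3_act g (mconst c) = mconst c"
  by (simp add: GL3_act_single linear_subst_def)

text \<open>The identity matrix is the base point from which leading monomials are carried to
  general coordinates.\<close>

lemma GL3_act_mat_1: "GL3_act (mat 1) p = (p :: 'a::field poly3)"
proof -
  have "GL3_act (mat 1) (single m 1) = single m (1 :: 'a)" for m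
  proof (induction m rule: poly_mapping_single_add_induct)
    case zero
    show ?case using GL3_act_mconst[of "mat 1" 1] .
  next
    case (single i k)
    show ?case
    proof (induction k)
      case 0
      show ?case using GL3_act_mconst[of "mat 1" 1] by simp
    next
      case (Suc k)
      have "GL3_act (mat 1 :: 'a ^ 3 ^ 3) (mvar i) =
          (\<Sum>j\<in>UNIV. if j = i then mvar j else 0)"
        unfolding GL3_act_mvar by (intro sum.cong refl) (simp add: mat_def)
      then have "GL3_act (mat 1 :: 'a ^ 3 ^ 3) (mvar i) = mvar i"
        by (simp add: sum.delta)
      moreover have "single (single i (Suc k)) (1 :: 'a) = mvar i * single (single i k) 1"
        by (simp add: mult_single single_add[symmetric])
      ultimately show ?case
        using Suc by (simp only: GL3_act_mult)
    qed
  next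
    case (add m n)
    have "single (m + n) (1 :: 'a) = single m 1 * single n 1"
      by (simp add: mult_single)
    then show ?case using add by (simp add: GL3_act_mult)
  qed
  moreover have "single m c = mconst c * single m 1" for m and c :: 'a
    by (simp add: mult_single)
  ultimately have single: "GL3_act (mat 1) (single m c) = single m c" for m and c :: 'a
    by (metis GL3_act_mult GL3_act_mconst)
  then show ?thesis
    by (induction p rule: poly_mapping_single_add_induct) (simp_all add: GL3_act_0 GL3_act_add)
qed

text \<open>Surjectivity on monomials makes the image of an ideal closed under multiplication by
  monomials. Row \<open>i\<close> of the inverse matrix gives a preimage of the \<open>i\<close>-th
  variable; products give the rest.\<close>

lemma monomial_in_range_GL3_act:
  fixes g :: "'k::field ^ 3 ^ 3"
  assumes "invertible g"
  shows "\<exists>p. GL3_act g p = single m 1"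
proof (induction m rule: poly_mapping_single_add_induct)
  case zero
  show ?case using GL3_act_1[of g] by auto
next
  case (single i k)
  obtain h where h: "h ** g = mat 1"
    using assms unfolding invertible_def by blast
  have "GL3_act g (\<Sum>j\<in>UNIV. mconst (h $ i $ j) * mvar j) =
      (\<Sum>j\<in>UNIV. mconst (h $ i $ j) * (\<Sum>l\<in>UNIV. mconst (g $ j $ l) * mvar l))"
    by (simp only: GL3_act_sum GL3_act_mult GL3_act_mconst GL3_act_mvar)
  also have "\<dots> = (\<Sum>l\<in>UNIV. \<Sum>j\<in>UNIV. mconst (h $ i $ j * g $ j $ l) * mvar l)"
    unfolding sum_distrib_left
    by (subst sum.swap) (simp add: mult_single mult.assoc)
  also have "\<dots> = (\<Sum>l\<in>UNIV. single (single l 1) ((h ** g) $ i $ l))"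
    by (intro sum.cong refl)
      (simp add: matrix_matrix_mult_def mult_single sum_3 single_add[symmetric])
  also have "\<dots> = (\<Sum>l\<in>UNIV. if l = i then mvar l else 0)"
    by (intro sum.cong refl) (simp add: h mat_def)
  also have "\<dots> = mvar i"
    by (simp add: sum.delta)
  finally have var: "GL3_act g (\<Sum>j\<in>UNIV. mconst (h $ i $ j) * mvar j) = mvar i" .
  show ?case
  proof (induction k)
    case 0
    show ?case using GL3_act_1[of g] by auto
  next
    case (Suc k)
    then obtain p where p: "GL3_act g p = single (single i k) 1" by blast
    have "single (single i (Suc k)) (1 :: 'k) = mvar i * single (single i k) 1"
      by (simp add: mult_single single_add[symmetric])
    then have "GL3_act g ((\<Sum>j\<in>UNIV. mconst (h $ i $ j) * mvar j) * p) = single (single i (Suc k)) 1"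
      by (simp only: GL3_act_mult var p)
    then show ?case ..
  qed
next
  case (add m n)
  then obtain p q where "GL3_act g p = single m 1" "GL3_act g q = single n 1" by blast
  then have "GL3_act g (p * q) = single (m + n) 1"
    by (simp add: GL3_act_mult mult_single)
  then show ?case ..
qed

section \<open>Polynomials with regularly varying coefficients\<close>

definition regular_poly :: "'v set \<Rightarrow> (('v \<Rightarrow> 'k::field) \<Rightarrow> 'k poly3) \<Rightarrow> bool"
  where "regular_poly X F \<longleftrightarrow> (\<forall>u. regular X (\<lambda>a. lookup (F a) u))"

lemma regular_poly_const: "regular_poly X (\<lambda>_. p)"
  by (simp add: regular_poly_def regular_const)

lemma regular_poly_single:
  assumes "regular X f"
  shows "regular_poly X (\<lambda>a. single m (f a))"
  unfolding regular_poly_def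
proof
  fix u
  show "regular X (\<lambda>a. lookup (single m (f a)) u)"
    using assms by (cases "m = u") (simp_all add: lookup_single regular_const)
qed

lemma regular_poly_sum:
  "(\<And>i. i \<in> A \<Longrightarrow> regular_poly X (F i)) \<Longrightarrow> regular_poly X (\<lambda>a. \<Sum>i\<in>A. F i a)"
  by (simp add: regular_poly_def lookup_sum regular_sum)

lemma finite_antidiagonal: "finite {(s, t). s + t = (u :: 3 monom)}"
proof (rule finite_subset)
  show "{(s, t). s + t = u} \<subseteq> (\<Union>n\<le>tdeg u. Delta n) \<times> (\<Union>n\<le>tdeg u. Delta n)"
    by (auto simp: Delta_eq tdeg_add)
qed (simp add: finite_Delta)

text \<open>The index set depends on \<open>u\<close> alone, not on the supports of the factors,
  which may vary with a parameter. Hence products preserve regularity of coefficients.\<close>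

lemma lookup_mult_antidiagonal:
  fixes p q :: "'k::comm_ring_1 poly3"
  shows "lookup (p * q) u = (\<Sum>(s, t)\<in>{(s, t). s + t = u}. lookup p s * lookup q t)"
proof (induction p rule: poly_mapping_single_add_induct)
  case zero
  then show ?case by simp
next
  case (single m c)
  show ?case
  proof (induction q rule: poly_mapping_single_add_induct)
    case zero
    then show ?case by simp
  next
    case (single n d)
    have "(\<Sum>(s, t)\<in>{(s, t). s + t = u}. lookup (single m c) s * lookup (single n d) t) =
        (\<Sum>x\<in>{(s, t). s + t = u}. if x = (m, n) then c * d else 0)"
      by (intro sum.cong) (auto simp: lookup_single when_def split: if_splits)
    also have "\<dots> = lookup (single m c * single n d) u"
      using finite_antidiagonal[of u] by (simp add: sum.delta mult_single lookup_single when_def)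
    finally show ?case ..
  next
    case (add q1 q2)
    then show ?case
      by (simp add: distrib_left lookup_add sum.distrib split_def)
  qed
next
  case (add p1 p2)
  then show ?case
    by (simp add: distrib_right lookup_add sum.distrib split_def)
qed

lemma regular_poly_mult:
  assumes "regular_poly X F" "regular_poly X G"
  shows "regular_poly X (\<lambda>a. F a * G a)"
  using assms unfolding regular_poly_def lookup_mult_antidiagonal split_def
  by (intro allI regular_sum regular_mult) auto

lemma regular_poly_power: "regular_poly X F \<Longrightarrow> regular_poly X (\<lambda>a. F a ^ k)"
  by (induction k) (simp_all add: regular_poly_mult regular_poly_const)

lemma regular_poly_prod:
  "(\<And>i. i \<in> A \<Longrightarrow> regular_poly X (F i)) \<Longrightarrow> regular_poly X (\<lambda>a. \<Prod>i\<in>A. F i a)"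
  by (induction A rule: infinite_finite_induct) (simp_all add: regular_poly_mult regular_poly_const)

section \<open>Matrices as points of affine space\<close>

definition mat_of :: "(3 \<times> 3 \<Rightarrow> 'k) \<Rightarrow> 'k ^ 3 ^ 3"
  where "mat_of a = (\<chi> i j. a (i, j))"

lemma mat_of_entries [simp]: "mat_of (\<lambda>(i, j). g $ i $ j) = g"
  by (simp add: mat_of_def vec_eq_iff)

lemma entries_mat_of [simp]: "(\<lambda>(i, j). mat_of a $ i $ j) = a"
  by (auto simp: mat_of_def)

lemma regular_poly_GL3_act: "regular_poly UNIV (\<lambda>a. GL3_act (mat_of a) p)"
  unfolding GL3_act_def mat_of_def
  by (intro regular_poly_sum regular_poly_mult regular_poly_prod regular_poly_power
      regular_poly_const regular_poly_single) (simp add: regular_coord)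

lemma regular_det: "regular UNIV (\<lambda>a. det (mat_of a))"
  unfolding det_def mat_of_def
  by (intro regular_sum regular_mult regular_prod regular_const) (simp add: regular_coord)

text \<open>Irreducibility of \<open>GL\<^sub>3\<close>, which makes the generic initial ideal
  unique. Each set contains a nonempty principal open subset of the affine space of matrices, the
  determinant being one factor of its equation.\<close>

lemma zariski_open_GL3_Int:
  fixes V V' :: "('k::field_char_0 ^ 3 ^ 3) set"
  assumes "zariski_open_GL3 V" "V \<noteq> {}" "zariski_open_GL3 V'" "V' \<noteq> {}"
  shows "V \<inter> V' \<noteq> {}"
proof -
  have *: "\<exists>f. regular_nz UNIV f \<and> (\<forall>a. f a \<noteq> 0 \<longrightarrow> mat_of a \<in> V)"
    if V: "zariski_open_GL3 V" "V \<noteq> {}" for V :: "('k ^ 3 ^ 3) set"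
  proof -
    obtain W where W: "zariski_open UNIV W"
      "V = {g. invertible g \<and> (\<lambda>(i, j). g $ i $ j) \<in> W}"
      using V(1) unfolding zariski_open_GL3_def by blast
    obtain g where g: "invertible g" "(\<lambda>(i, j). g $ i $ j) \<in> W"
      using V(2) W(2) by blast
    obtain f where f: "regular UNIV f" "f (\<lambda>(i, j). g $ i $ j) \<noteq> 0" "{b \<in> UNIV \<rightarrow>\<^sub>E UNIV. f b \<noteq> 0} \<subseteq> W"
      using zariski_open_contains_nonvanishing[OF W(1) g(2)] by blast
    have "regular_nz UNIV (\<lambda>a. det (mat_of a) * f a)"
      unfolding regular_nz_def
    proof (intro conjI bexI)
      show "det (mat_of (\<lambda>(i, j). g $ i $ j)) * f (\<lambda>(i, j). g $ i $ j) \<noteq> 0"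
        using g(1) f(2) by (simp add: invertible_det_nz)
      show "regular UNIV (\<lambda>a. det (mat_of a) * f a)"
        using regular_det f(1) by (rule regular_mult)
    qed simp
    moreover have "mat_of a \<in> V" if "det (mat_of a) * f a \<noteq> 0" for a
    proof -
      have "a \<in> W" using that f(3) by auto
      then show ?thesis
        using that W(2) by (simp add: invertible_det_nz)
    qed
    ultimately show ?thesis by (intro exI[of _ "\<lambda>a. det (mat_of a) * f a"] conjI allI impI)
  qed
  obtain f where f: "regular_nz UNIV f" "\<forall>a. f a \<noteq> 0 \<longrightarrow> mat_of a \<in> V"
    using *[OF assms(1,2)] by blast
  obtain f' where f': "regular_nz UNIV f'" "\<forall>a. f' a \<noteq> 0 \<longrightarrow> mat_of a \<in> V'"
    using *[OF assms(3,4)] by blast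
  have "regular_nz UNIV (\<lambda>a. f a * f' a)"
    using f(1) f'(1) by (rule regular_nz_mult)
  then obtain a where "f a * f' a \<noteq> 0"
    unfolding regular_nz_def by blast
  then show ?thesis
    using f(2) f'(2) by auto
qed

section \<open>Leading monomials of form ideals\<close>

text \<open>Avoids the definite description in \<open>initial_monom\<close>; the zero polynomial is
  excluded because \<open>u\<close> must lie in its support.\<close>

definition lead_monoms :: "'v monom rel \<Rightarrow> ('v, 'k::comm_ring_1) mpoly set \<Rightarrow> 'v monom set"
  where "lead_monoms r J = {u. \<exists>p\<in>J. u \<in> keys p \<and> (\<forall>s\<in>keys p. (s, u) \<in> r)}"

lemma initial_monom_eq:
  assumes "linear_order r" "u \<in> keys p" "\<forall>s\<in>keys p. (s, u) \<in> r"
  shows "initial_monom r p = u"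
  unfolding initial_monom_def
  using assms by (intro the_equality) (auto intro: linear_order_antisym[OF assms(1)])

lemma initial_ideal_eq:
  assumes "linear_order r"
  shows "initial_ideal r J = ideal_generated ((\<lambda>u. single u 1) ` lead_monoms r J)"
proof -
  have "\<exists>u\<in>lead_monoms r J. initial_monom r p = u" if p: "p \<in> J" "p \<noteq> 0" for p
  proof -
    obtain u where "u \<in> keys p" "\<forall>s\<in>keys p. (s, u) \<in> r"
      using linear_order_finite_max[OF assms finite_keys[of p]] p by auto
    then show ?thesis
      using initial_monom_eq[OF assms] p unfolding lead_monoms_def by blast
  qed
  moreover have "\<exists>p\<in>J. p \<noteq> 0 \<and> initial_monom r p = u" if u: "u \<in> lead_monoms r J" for u
  proof -
    obtain p where "p \<in> J" "u \<in> keys p" "\<forall>s\<in>keys p. (s, u) \<in> r"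
      using u unfolding lead_monoms_def by blast
    then show ?thesis
      using initial_monom_eq[OF assms] by (intro bexI[of _ p]) auto
  qed
  ultimately have "{single (initial_monom r p) (1 :: 'b) |p. p \<in> J \<and> p \<noteq> 0} =
      (\<lambda>u. single u 1) ` lead_monoms r J"
    by (auto simp: image_iff)
  then show ?thesis
    by (simp add: initial_ideal_def)
qed

text \<open>Divisibility by a generator passes from the generators to multiples and sums.\<close>

lemma keys_monomial_ideal:
  assumes "p \<in> ideal_generated ((\<lambda>u. single u (1 :: 'k::comm_ring_1)) ` M)" "k \<in> keys p"
  shows "\<exists>m\<in>M. \<exists>v. k = m + v"
proof -
  have "\<forall>k\<in>keys p. \<exists>m\<in>M. \<exists>v. k = m + v"
    using assms(1)
  proof (induction rule: ideal.span_induct_alt)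
    case base
    show ?case by simp
  next
    case (step c x y)
    then obtain m where m: "m \<in> M" "x = single m 1" by blast
    show ?case
    proof
      fix k assume "k \<in> keys (c * x + y)"
      then consider "k \<in> keys (c * x)" | "k \<in> keys y"
        using Poly_Mapping.keys_add[of "c * x" y] by blast
      then show "\<exists>m\<in>M. \<exists>v. k = m + v"
      proof cases
        case 1
        then obtain v where "k = v + m"
          using Poly_Mapping.keys_mult[of c x] m(2) by (auto split: if_splits)
        then show ?thesis using m(1) by (metis add.commute)
      next
        case 2
        then show ?thesis using step.IH by blast
      qed
    qed
  qed
  then show ?thesis using assms(2) by blast
qed

lemma lookup_mult_monomial:
  "lookup (p * single v 1) (s + v) = lookup (p :: ('v, 'k::comm_ring_1) mpoly) s"
proof (induction p rule: poly_mapping_single_add_induct)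
  case (single m c)
  show ?case by (simp add: mult_single lookup_single when_def)
qed (simp_all add: distrib_right lookup_add)

lemma lead_monoms_add:
  assumes r: "term_order r" and J: "\<And>p. p \<in> J \<Longrightarrow> p * single v 1 \<in> J" and u: "u \<in> lead_monoms r J"
  shows "u + v \<in> lead_monoms r J"
proof -
  obtain p where p: "p \<in> J" "u \<in> keys p" "\<forall>s\<in>keys p. (s, u) \<in> r"
    using u unfolding lead_monoms_def by blast
  have "u + v \<in> keys (p * single v 1)"
    using p(2) by (simp add: in_keys_iff lookup_mult_monomial)
  moreover have "(s, u + v) \<in> r" if s: "s \<in> keys (p * single v 1)" for s
  proof -
    obtain t where "t \<in> keys p" "s = t + v"
      using s Poly_Mapping.keys_mult[of p "single v 1"] by (auto split: if_splits)
    then show ?thesis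
      using p(3) r by (simp add: term_order_def)
  qed
  ultimately show ?thesis
    using J[OF p(1)] unfolding lead_monoms_def by blast
qed

text \<open>Row indices of the Macaulay matrix in degree \<open>n\<close>: the multiples of the
  forms by monomials. Writing \<open>tdeg \<mu> + d = n\<close> instead of a truncated difference
  leaves no rows for \<open>n < d\<close>.\<close>

definition shifts :: "nat \<Rightarrow> nat \<Rightarrow> (3 monom \<times> nat) set"
  where "shifts d n = {\<mu>. tdeg \<mu> + d = n} \<times> {1..d + 1}"

definition shifted_form :: "nat \<Rightarrow> (nat \<times> 3 monom \<Rightarrow> 'k::field) \<Rightarrow> 3 monom \<times> nat \<Rightarrow> 'k poly3"
  where "shifted_form d q = (\<lambda>(\<mu>, i). single \<mu> 1 * form d q i)"

lemma finite_shift_degrees: "finite {\<mu>. tdeg \<mu> + d = n}"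
  by (rule finite_subset[OF _ finite_Delta[of "n - d"]]) (auto simp: Delta_eq)

lemma finite_shifts: "finite (shifts d n)"
  unfolding shifts_def using finite_shift_degrees by simp

lemma shifts_self: "shifts d d = {0} \<times> {1..d + 1}"
proof -
  have "tdeg \<mu> = 0 \<longleftrightarrow> \<mu> = 0" for \<mu>
    by (auto intro: monom3_eqI simp: tdeg_def)
  then show ?thesis by (simp add: shifts_def)
qed

lemma homogeneous_shifted_form: "homogeneous (tdeg \<mu> + d) (shifted_form d q (\<mu>, i))"
  unfolding shifted_form_def prod.case form_def
  by (intro homogeneous_mult homogeneous_sum homogeneous_single refl) (simp add: Delta_eq)

lemma lookup_mconst_mult: "lookup (mconst c * p) u = c * lookup (p :: ('v, 'k::comm_ring_1) mpoly) u"
proof (induction p rule: poly_mapping_single_add_induct)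
  case (single m c)
  show ?case by (simp add: mult_single lookup_single when_def)
qed (simp_all add: distrib_left lookup_add)

lemma in_form_ideal:
  assumes "p \<in> form_ideal d q"
  shows "\<exists>h. p = (\<Sum>i\<in>{1..d + 1}. h i * form d q i)"
  using assms unfolding form_ideal_def
proof (induction rule: ideal.span_induct_alt)
  case base
  show ?case by (intro exI[of _ "\<lambda>_. 0"]) simp
next
  case (step c x y)
  then obtain h j where h: "y = (\<Sum>i\<in>{1..d + 1}. h i * form d q i)"
    and j: "j \<in> {1..d + 1}" "x = form d q j" by blast
  have "(\<Sum>i\<in>{1..d + 1}. of_bool (i = j) * c * form d q i) = c * x"
    unfolding sum.remove[OF finite_atLeastAtMost j(1)] by (simp add: j(2) sum.neutral)
  then have "c * x + y = (\<Sum>i\<in>{1..d + 1}. (of_bool (i = j) * c + h i) * form d q i)"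
    by (simp only: distrib_right sum.distrib h)
  then show ?case
    by (rule exI[of _ "\<lambda>i. of_bool (i = j) * c + h i"])
qed

text \<open>The substitution preserves degrees, so only terms of \<open>h i\<close> of degree
  \<open>n - d\<close> reach degree \<open>n\<close>. The coefficients on the right do not depend on
  \<open>u\<close>, so this is one linear combination of rows.\<close>

lemma lookup_GL3_act_form_ideal:
  fixes h :: "nat \<Rightarrow> 'k::field poly3"
  assumes p: "p = (\<Sum>i\<in>{1..d + 1}. h i * form d q i)" and u: "u \<in> Delta n"
  shows "lookup (GL3_act g p) u =
    (\<Sum>x\<in>shifts d n. lookup (h (snd x)) (fst x) * lookup (GL3_act g (shifted_form d q x)) u)"
proof -
  let ?c = "\<lambda>\<mu> i. lookup (h i) \<mu> * lookup (GL3_act g (shifted_form d q (\<mu>, i))) u"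
  have hi: "h i * form d q i = (\<Sum>\<mu>\<in>keys (h i). mconst (lookup (h i) \<mu>) * shifted_form d q (\<mu>, i))" for i
  proof -
    have "h i * form d q i = (\<Sum>\<mu>\<in>keys (h i). single \<mu> (lookup (h i) \<mu>)) * form d q i"
      by (simp only: sum_single_lookup)
    then show ?thesis
      by (simp add: sum_distrib_right shifted_form_def mult.assoc[symmetric] mult_single)
  qed
  have zero: "lookup (GL3_act g (shifted_form d q (\<mu>, i))) u = 0" if "tdeg \<mu> + d \<noteq> n" for \<mu> i
    using homogeneous_GL3_act[OF homogeneous_shifted_form[of \<mu> d q i], of g] that u
    by (auto simp: homogeneous_def Delta_eq in_keys_iff)
  have "lookup (GL3_act g p) u = (\<Sum>i\<in>{1..d + 1}. \<Sum>\<mu>\<in>keys (h i). ?c \<mu> i)"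
    unfolding p hi by (simp only: GL3_act_sum GL3_act_mult GL3_act_mconst lookup_sum lookup_mconst_mult)
  \<comment> \<open>Both changes of the index set are harmless: terms of other degrees contribute 0,
    and so do monomials outside the support of \<open>h i\<close>.\<close>
  also have "\<dots> = (\<Sum>i\<in>{1..d + 1}. \<Sum>\<mu>\<in>{\<mu>. tdeg \<mu> + d = n}. ?c \<mu> i)"
    using finite_shift_degrees
    by (intro sum.cong refl sum.mono_neutral_cong) (auto simp: zero in_keys_iff)
  also have "\<dots> = (\<Sum>x\<in>shifts d n. ?c (fst x) (snd x))"
    by (subst sum.swap) (simp only: sum.cartesian_product shifts_def split_def)
  finally show ?thesis by simp
qed

text \<open>Reduces each degree to linear algebra: the leading monomials are the pivots of a
  Macaulay matrix. A leading monomial of an inhomogeneous element also leads its degree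
  \<open>n\<close> component.\<close>

lemma lead_monoms_form_ideal:
  fixes q :: "nat \<times> 3 monom \<Rightarrow> 'k::field"
  assumes "linear_order r"
  shows "lead_monoms r (GL3_act g ` form_ideal d q) \<inter> Delta n =
    leads r (Delta n) (shifts d n) (\<lambda>x. lookup (GL3_act g (shifted_form d q x)))"
    (is "?M \<inter> _ = ?L")
proof
  show "?M \<inter> Delta n \<subseteq> ?L"
  proof
    fix u assume u: "u \<in> ?M \<inter> Delta n"
    then obtain p where p: "p \<in> form_ideal d q" "u \<in> keys (GL3_act g p)"
      "\<forall>s\<in>keys (GL3_act g p). (s, u) \<in> r"
      unfolding lead_monoms_def by blast
    obtain h where "p = (\<Sum>i\<in>{1..d + 1}. h i * form d q i)"
      using in_form_ideal[OF p(1)] by blast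
    note coeff = lookup_GL3_act_form_ideal[OF this, of _ n g]
    show "u \<in> ?L"
      unfolding leads_def
    proof (intro CollectI conjI exI ballI impI)
      show "u \<in> Delta n" using u by simp
      then show "(\<Sum>x\<in>shifts d n. lookup (h (snd x)) (fst x) * lookup (GL3_act g (shifted_form d q x)) u) \<noteq> 0"
        using p(2) by (simp only: coeff[symmetric] in_keys_iff not_False_eq_True)
      fix s assume "s \<in> Delta n"
        "(\<Sum>x\<in>shifts d n. lookup (h (snd x)) (fst x) * lookup (GL3_act g (shifted_form d q x)) s) \<noteq> 0"
      then show "(s, u) \<in> r"
        using p(3) by (simp only: coeff[symmetric] in_keys_iff Ball_def) blast
    qed
  qed
  show "?L \<subseteq> ?M \<inter> Delta n"
  proof
    fix u assume "u \<in> ?L"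
    then obtain c where u: "u \<in> Delta n"
      and c: "(\<Sum>x\<in>shifts d n. c x * lookup (GL3_act g (shifted_form d q x)) u) \<noteq> 0"
      "\<forall>s\<in>Delta n. (\<Sum>x\<in>shifts d n. c x * lookup (GL3_act g (shifted_form d q x)) s) \<noteq> 0 \<longrightarrow> (s, u) \<in> r"
      unfolding leads_def by blast
    define p where "p = (\<Sum>x\<in>shifts d n. mconst (c x) * shifted_form d q x)"
    have p: "p \<in> form_ideal d q"
      unfolding p_def form_ideal_def shifted_form_def split_def
      by (intro ideal.span_sum ideal.span_scale ideal.span_base) (auto simp: shifts_def)
    have coeff: "lookup (GL3_act g p) s = (\<Sum>x\<in>shifts d n. c x * lookup (GL3_act g (shifted_form d q x)) s)" for s
      unfolding p_def by (simp only: GL3_act_sum GL3_act_mult GL3_act_mconst lookup_sum lookup_mconst_mult)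
    have "homogeneous n p"
      unfolding p_def
    proof (rule homogeneous_sum)
      fix x assume "x \<in> shifts d n"
      then have "homogeneous n (shifted_form d q x)"
        using homogeneous_shifted_form[of "fst x" d q "snd x"] by (auto simp: shifts_def)
      then show "homogeneous n (mconst (c x) * shifted_form d q x)"
        using homogeneous_mult[OF homogeneous_single[OF tdeg_0]] by fastforce
    qed
    then have "keys (GL3_act g p) \<subseteq> Delta n"
      using homogeneous_GL3_act[of n p g] by (simp add: homogeneous_def)
    then have "u \<in> keys (GL3_act g p)" "\<forall>s\<in>keys (GL3_act g p). (s, u) \<in> r"
      using c by (auto simp: coeff[symmetric] in_keys_iff)
    then show "u \<in> ?M \<inter> Delta n"
      using p u unfolding lead_monoms_def by blast
  qed
qed

lemma lead_monoms_form_ideal_add: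
  assumes "term_order r" "invertible g" "u \<in> lead_monoms r (GL3_act g ` form_ideal d q)"
  shows "u + v \<in> lead_monoms r (GL3_act g ` form_ideal d q)"
proof (rule lead_monoms_add[OF assms(1) _ assms(3)])
  fix p assume "p \<in> GL3_act g ` form_ideal d q"
  then obtain p' where p': "p' \<in> form_ideal d q" "p = GL3_act g p'" by blast
  obtain m where m: "GL3_act g m = single v 1"
    using monomial_in_range_GL3_act[OF assms(2)] by blast
  have "m * p' \<in> form_ideal d q"
    using p'(1) unfolding form_ideal_def by (rule ideal.span_scale)
  moreover have "p * single v 1 = GL3_act g (m * p')"
    by (simp add: GL3_act_mult m p'(2) mult.commute)
  ultimately show "p * single v 1 \<in> GL3_act g ` form_ideal d q" by blast
qed

section \<open>Generic initial ideals of form ideals\<close>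

text \<open>\<open>N\<close> and \<open>T\<close> concern the given coordinates, and semicontinuity
  transfers both to general ones. Degrees below \<open>N\<close> are settled by
  \<open>generic_leads\<close>, degree \<open>N\<close> is full, and higher degrees follow by
  multiplication.\<close>

lemma gin_form_ideal:
  fixes q :: "nat \<times> 3 monom \<Rightarrow> 'k::field_char_0"
  assumes r: "term_order r"
    and N: "Delta N \<subseteq> leads r (Delta N) (shifts d N) (\<lambda>x. lookup (shifted_form d q x))"
    and T: "T \<subseteq> leads r (Delta d) (shifts d d) (\<lambda>x. lookup (shifted_form d q x))"
    and up: "\<And>s t. t \<in> T \<Longrightarrow> s \<in> Delta d \<Longrightarrow> (t, s) \<in> r \<Longrightarrow> s \<in> T"
    and card: "card T = d + 1"
    and u: "u \<in> Delta d"
  shows "single u 1 \<in> gin r (form_ideal d q) \<longleftrightarrow> u \<in> T"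
proof -
  let ?I = "form_ideal d q"
  let ?F = "\<lambda>x a. lookup (GL3_act (mat_of a) (shifted_form d q x))"
  let ?M = "\<lambda>a. lead_monoms r (GL3_act (mat_of a) ` ?I)"
  define b :: "3 \<times> 3 \<Rightarrow> 'k" where "b = (\<lambda>(i, j). mat 1 $ i $ j)"
  have b: "mat_of b = mat 1"
    unfolding b_def by simp
  have lin: "linear_order r"
    using r by (simp add: term_order_def)
  have reg: "\<forall>u\<in>S. regular UNIV (\<lambda>a. ?F x a u)" for x S
    using regular_poly_GL3_act unfolding regular_poly_def by blast
  have M: "?M a \<inter> Delta n = leads r (Delta n) (shifts d n) (\<lambda>x. ?F x a)" for a n
    by (rule lead_monoms_form_ideal[OF lin])
  have "\<exists>f B. regular_nz UNIV f \<and> (\<forall>a. f a \<noteq> 0 \<longrightarrow> ?M a \<inter> Delta n = B)" for n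
    using generic_leads[OF lin finite_Delta finite_shifts reg, of n d n] unfolding M by simp
  then obtain e B where e: "\<And>n. regular_nz UNIV (e n)"
    and B: "\<And>n a. e n a \<noteq> 0 \<Longrightarrow> ?M a \<inter> Delta n = B n"
    by metis
  have "\<exists>f. regular UNIV f \<and> f b \<noteq> 0 \<and>
      (\<forall>a. f a \<noteq> 0 \<longrightarrow> Delta N \<subseteq> leads r (Delta N) (shifts d N) (\<lambda>x. ?F x a))"
    by (rule leads_semicontinuous[OF lin finite_Delta finite_shifts reg]) (simp_all add: b GL3_act_mat_1 N)
  then obtain f where f: "regular UNIV f" "f b \<noteq> 0" "\<And>a. f a \<noteq> 0 \<Longrightarrow> Delta N \<subseteq> ?M a"
    unfolding M[symmetric] by blast
  have "\<exists>f. regular UNIV f \<and> f b \<noteq> 0 \<and>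
      (\<forall>a. f a \<noteq> 0 \<longrightarrow> T \<subseteq> leads r (Delta d) (shifts d d) (\<lambda>x. ?F x a))"
    by (rule leads_semicontinuous[OF lin finite_Delta finite_shifts reg]) (use up in \<open>simp_all add: b GL3_act_mat_1 T\<close>)
  then obtain f' where f': "regular UNIV f'" "f' b \<noteq> 0"
    "\<And>a. f' a \<noteq> 0 \<Longrightarrow> T \<subseteq> leads r (Delta d) (shifts d d) (\<lambda>x. ?F x a)"
    by blast
  \<comment> \<open>Only finitely many degrees enter, so all conditions fit into one product; the
    determinant keeps the matrix invertible.\<close>
  define w where "w a = (\<Prod>n<N. e n a) * (f a * (f' a * det (mat_of a)))" for a
  have "regular_nz UNIV f" "regular_nz UNIV f'" "regular_nz UNIV (\<lambda>a. det (mat_of a) :: 'k)"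
    using f f' regular_det b unfolding regular_nz_def
    by (auto intro!: exI[of _ b])
  then have w: "regular_nz UNIV w"
    unfolding w_def by (intro regular_nz_mult regular_nz_prod e)
  \<comment> \<open>The common set of leading monomials, independent of the coordinates.\<close>
  define M0 where "M0 = (\<Union>n<N. B n) \<union> {u. N \<le> tdeg u}"
  have M0: "?M a = M0" if "w a \<noteq> 0" for a
  proof -
    have a: "\<And>n. n < N \<Longrightarrow> e n a \<noteq> 0" "f a \<noteq> 0" "invertible (mat_of a)"
      using that by (auto simp: w_def invertible_det_nz)
    have "u \<in> ?M a \<longleftrightarrow> u \<in> M0" for u
    proof (cases "N \<le> tdeg u")
      case True
      then obtain s v where "u = s + v" "tdeg s = N"
        using tdeg_split by blast
      then show ?thesis
        using f(3)[OF a(2)] lead_monoms_form_ideal_add[OF r a(3)] True by (auto simp: M0_def Delta_eq)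
    next
      case False
      then have "u \<in> ?M a \<longleftrightarrow> u \<in> B (tdeg u)"
        using B[OF a(1), of "tdeg u"] by (auto simp: Delta_eq)
      moreover have "B n \<subseteq> Delta n" if "n < N" for n
        using B[OF a(1)[OF that]] by blast
      ultimately show ?thesis
        using False by (auto simp: M0_def Delta_eq)
    qed
    then show ?thesis by blast
  qed
  define J where "J = ideal_generated ((\<lambda>u. single u (1 :: 'k)) ` M0)"
  define V where "V = {g. invertible g \<and> (\<lambda>(i, j). g $ i $ j) \<in> {a \<in> UNIV \<rightarrow>\<^sub>E UNIV. w a \<noteq> 0}}"
  have "zariski_open_GL3 V"
    unfolding zariski_open_GL3_def V_def
    using zariski_open_nonvanishing[of UNIV w] w by (auto simp: regular_nz_def)
  moreover obtain a0 where a0: "w a0 \<noteq> 0"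
    using w unfolding regular_nz_def by blast
  then have "mat_of a0 \<in> V"
    by (simp add: V_def w_def invertible_det_nz)
  moreover have J: "initial_ideal r (GL3_act g ` ?I) = J" if "g \<in> V" for g
    using M0[of "\<lambda>(i, j). g $ i $ j"] that
    by (simp add: V_def J_def initial_ideal_eq[OF lin])
  ultimately have V: "zariski_open_GL3 V \<and> V \<noteq> {} \<and> (\<forall>g\<in>V. initial_ideal r (GL3_act g ` ?I) = J)"
    by blast
  have "gin r ?I = J"
    unfolding gin_def
  proof (rule the_equality)
    show "\<exists>V. zariski_open_GL3 V \<and> V \<noteq> {} \<and> (\<forall>g\<in>V. initial_ideal r (GL3_act g ` ?I) = J)"
      using V by blast
    fix J' assume "\<exists>V. zariski_open_GL3 V \<and> V \<noteq> {} \<and> (\<forall>g\<in>V. initial_ideal r (GL3_act g ` ?I) = J')"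
    then obtain V' where V': "zariski_open_GL3 V'" "V' \<noteq> {}"
      "\<forall>g\<in>V'. initial_ideal r (GL3_act g ` ?I) = J'" by blast
    then obtain g where "g \<in> V \<inter> V'"
      using zariski_open_GL3_Int[of V V'] V by blast
    then show "J' = J"
      using V V' by blast
  qed
  moreover have "single u 1 \<in> J \<longleftrightarrow> u \<in> ?M a0"
  proof
    assume "single u 1 \<in> J"
    then obtain m v where "m \<in> M0" "u = m + v"
      using keys_monomial_ideal[of "single u 1" M0 u] unfolding J_def by auto
    moreover have "invertible (mat_of a0)"
      using a0 by (simp add: w_def invertible_det_nz)
    ultimately show "u \<in> ?M a0"
      using lead_monoms_form_ideal_add[OF r, of "mat_of a0" m d q v] M0[OF a0] by simp
  next
    assume "u \<in> ?M a0"
    then show "single u 1 \<in> J"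
      unfolding J_def M0[OF a0] by (intro ideal.span_base) blast
  qed
  moreover have "?M a0 \<inter> Delta d = T"
  proof -
    have "T \<subseteq> ?M a0 \<inter> Delta d"
      using f'(3)[of a0] a0 by (simp only: M) (simp add: w_def)
    \<comment> \<open>In degree \<open>d\<close> the matrix has just \<open>d + 1\<close> rows, so
      there is no room for a leading monomial outside \<open>T\<close>.\<close>
    moreover have "card (?M a0 \<inter> Delta d) \<le> card T"
      using card_leads_le[OF lin finite_Delta finite_shifts, of d d d "\<lambda>x. ?F x a0"]
      by (simp add: M card shifts_self)
    ultimately show ?thesis
      using card_seteq[of "?M a0 \<inter> Delta d" T] finite_Delta by simp
  qed
  ultimately show ?thesis
    using u by blast
qed

section \<open>Points of the parameter space\<close>

text \<open>The parameter point at which the \<open>i\<close>-th form is the monomial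
  \<open>e i\<close>; \<open>restrict\<close> makes it a point of the affine space.\<close>

definition monomial_forms :: "nat \<Rightarrow> (nat \<Rightarrow> 3 monom) \<Rightarrow> nat \<times> 3 monom \<Rightarrow> 'k::field"
  where "monomial_forms d e = restrict (\<lambda>(i, \<nu>). of_bool (\<nu> = e i)) ({1..d + 1} \<times> Delta d)"

lemma form_monomial_forms:
  assumes "i \<in> {1..d + 1}" "e i \<in> Delta d"
  shows "form d (monomial_forms d e) i = single (e i) 1"
proof -
  have "form d (monomial_forms d e) i = (\<Sum>\<nu>\<in>Delta d. if \<nu> = e i then single \<nu> 1 else 0)"
    unfolding form_def using assms by (intro sum.cong refl) (auto simp: monomial_forms_def)
  then show ?thesis
    using assms finite_Delta by (simp add: sum.delta)
qed

text \<open>Here row \<open>(\<mu>, i)\<close> is a unit vector, so its only nonzero position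
  leads.\<close>

lemma monomial_forms_leads:
  assumes "linear_order r" "i \<in> {1..d + 1}" "e i \<in> Delta d" "\<mu> + e i \<in> Delta n"
  shows "\<mu> + e i \<in> leads r (Delta n) (shifts d n)
    (\<lambda>x. lookup (shifted_form d (monomial_forms d e :: _ \<Rightarrow> 'k::field) x))"
proof -
  let ?V = "\<lambda>x. lookup (shifted_form d (monomial_forms d e :: _ \<Rightarrow> 'k) x)"
  have i: "(\<mu>, i) \<in> shifts d n"
    using assms by (auto simp: shifts_def Delta_eq tdeg_add)
  have "?V (\<mu>, i) = lookup (single (\<mu> + e i) 1)"
    unfolding shifted_form_def prod.case form_monomial_forms[where e = e, OF assms(2,3)]
    by (simp add: mult_single)
  then have sum: "(\<Sum>x\<in>shifts d n. of_bool (x = (\<mu>, i)) * ?V x s) = lookup (single (\<mu> + e i) 1) s" for s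
    unfolding sum.remove[OF finite_shifts i] by (simp add: sum.neutral)
  show ?thesis
    unfolding leads_def
  proof (intro CollectI conjI exI[of _ "\<lambda>x. of_bool (x = (\<mu>, i))"] ballI impI, unfold sum)
    show "(s, \<mu> + e i) \<in> r" if "lookup (single (\<mu> + e i) (1 :: 'k)) s \<noteq> 0" for s
      using that linear_order_refl[OF assms(1)] by (auto simp: lookup_single when_def split: if_splits)
  qed (use assms(4) in simp_all)
qed

lemma regular_poly_shifted_form:
  assumes "x \<in> shifts d n"
  shows "regular_poly ({1..d + 1} \<times> Delta d) (\<lambda>q. shifted_form d q x)"
  using assms unfolding shifted_form_def split_def form_def
  by (intro regular_poly_mult regular_poly_const regular_poly_sum regular_poly_single regular_coord)
    (auto simp: shifts_def)

text \<open>Semicontinuity in the coefficients \<open>q\<close>, based at a point given by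
  monomials.\<close>

lemma generic_shifted_form_leads:
  assumes "linear_order r"
    and T: "T \<subseteq> leads r (Delta n) (shifts d n)
      (\<lambda>x. lookup (shifted_form d (monomial_forms d e :: _ \<Rightarrow> 'k::field) x))"
    and up: "\<And>s t. t \<in> T \<Longrightarrow> s \<in> Delta n \<Longrightarrow> (t, s) \<in> r \<Longrightarrow> s \<in> T"
  shows "\<exists>f. regular_nz ({1..d + 1} \<times> Delta d) f \<and> (\<forall>q. f q \<noteq> (0 :: 'k) \<longrightarrow>
    T \<subseteq> leads r (Delta n) (shifts d n) (\<lambda>x. lookup (shifted_form d q x)))"
proof -
  have reg: "\<forall>u\<in>Delta n. regular ({1..d + 1} \<times> Delta d)
      (\<lambda>q :: _ \<Rightarrow> 'k. lookup (shifted_form d q x) u)" if "x \<in> shifts d n" for x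
    using regular_poly_shifted_form[OF that] unfolding regular_poly_def by blast
  have "\<exists>f. regular ({1..d + 1} \<times> Delta d) f \<and> f (monomial_forms d e) \<noteq> (0 :: 'k) \<and>
      (\<forall>q. f q \<noteq> 0 \<longrightarrow> T \<subseteq> leads r (Delta n) (shifts d n) (\<lambda>x. lookup (shifted_form d q x)))"
    by (rule leads_semicontinuous[OF assms(1) finite_Delta finite_shifts]) (use reg T up in auto)
  moreover have "monomial_forms d e \<in> ({1..d + 1} \<times> Delta d) \<rightarrow>\<^sub>E UNIV"
    unfolding monomial_forms_def by (rule restrict_PiE_iff[THEN iffD2]) simp
  ultimately show ?thesis
    unfolding regular_nz_def by blast
qed

text \<open>Since \<open>of_nat 3 = 3 = 0\<close> in the index type, the first three forms are
  \<open>x\<^sup>d, y\<^sup>d, z\<^sup>d\<close>.\<close>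

lemma pure_powers_leads:
  assumes "linear_order r" "d \<ge> 2"
  shows "Delta (3 * d) \<subseteq> leads r (Delta (3 * d)) (shifts d (3 * d))
    (\<lambda>x. lookup (shifted_form d (monomial_forms d (\<lambda>i. single (of_nat i) d) :: _ \<Rightarrow> 'k::field) x))"
proof
  fix u assume u: "u \<in> Delta (3 * d)"
  then have "d \<le> lookup u 1 \<or> d \<le> lookup u 2 \<or> d \<le> lookup u 3"
    unfolding Delta_def by auto
  moreover have "(1 :: 3) = of_nat 1" "(2 :: 3) = of_nat 2" "(3 :: 3) = of_nat 3"
    by simp_all
  ultimately obtain i where "i = 1 \<or> i = 2 \<or> i = 3" and i: "d \<le> lookup u (of_nat i)"
    by metis
  \<comment> \<open>The index 3 is admissible because \<open>d + 1\<close> is at least 3.\<close>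
  then have "i \<in> {1..d + 1}"
    using assms(2) by auto
  moreover define \<mu> where "\<mu> = u - single (of_nat i) d"
  have u_eq: "u = \<mu> + single (of_nat i) d"
    using i by (intro poly_mapping_eqI) (auto simp: \<mu>_def lookup_add lookup_minus lookup_single when_def)
  moreover have "single (of_nat i) d \<in> Delta d"
    by (simp add: Delta_eq tdeg_single)
  ultimately show "u \<in> leads r (Delta (3 * d)) (shifts d (3 * d))
      (\<lambda>x. lookup (shifted_form d (monomial_forms d (\<lambda>i. single (of_nat i) d) :: _ \<Rightarrow> 'k) x))"
    using monomial_forms_leads[OF assms(1), of i d "\<lambda>i. single (of_nat i) d" \<mu> "3 * d"] u
    by simp
qed

section \<open>Weight orders\<close>

text \<open>With weights \<open>w, w - 2, 0\<close>, on monomials of degree \<open>d\<close> a larger weight means a smaller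
  \<open>2b + wc\<close>, where \<open>b\<close> and \<open>c\<close> are the exponents of \<open>y\<close> and \<open>z\<close>.\<close>

definition weight :: "nat \<Rightarrow> 3 monom \<Rightarrow> nat"
  where "weight w m = w * lookup m 1 + (w - 2) * lookup m 2"

definition weight_order :: "nat \<Rightarrow> 3 monom rel"
  where "weight_order w = {(m, n). weight w m < weight w n \<or> weight w m = weight w n \<and>
    (lookup m 1 < lookup n 1 \<or> lookup m 1 = lookup n 1 \<and>
    (lookup m 2 < lookup n 2 \<or> lookup m 2 = lookup n 2 \<and> lookup m 3 \<le> lookup n 3))}"

lemma weight_add: "weight w (m + n) = weight w m + weight w n"
  by (simp add: weight_def lookup_add distrib_left)

lemma term_order_weight_order: "term_order (weight_order w)"
proof -
  have "refl (weight_order w)"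
    by (auto simp: refl_on_def weight_order_def)
  moreover have "trans (weight_order w)"
    unfolding trans_def weight_order_def by clarsimp linarith
  moreover have "antisym (weight_order w)"
    unfolding antisym_def weight_order_def by (auto intro: monom3_eqI)
  moreover have "total (weight_order w)"
    unfolding total_on_def weight_order_def by (clarsimp, metis linorder_less_linear less_imp_le monom3_eqI)
  ultimately have "linear_order (weight_order w)"
    by (simp add: order_on_defs)
  moreover have "(0, m) \<in> weight_order w" for m
    by (auto simp: weight_order_def weight_def)
  moreover have "(m + l, n + l) \<in> weight_order w" if "(m, n) \<in> weight_order w" for l m n
    using that by (auto simp: weight_order_def weight_add lookup_add)
  ultimately show ?thesis
    by (simp add: term_order_def)
qed

text \<open>Eliminates the exponent of \<open>x\<close> by means of the degree. The additive form
  and \<open>w \<ge> 2\<close> avoid truncated subtraction.\<close>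

lemma weight_Delta:
  assumes "w \<ge> 2" "m \<in> Delta d"
  shows "weight w m + (2 * lookup m 2 + w * lookup m 3) = w * d"
proof -
  obtain v where "w = v + 2"
    using assms(1) by (metis le_add_diff_inverse2)
  moreover have "d = lookup m 1 + lookup m 2 + lookup m 3"
    using assms(2) by (simp add: Delta_def)
  ultimately show ?thesis
    by (simp add: weight_def algebra_simps)
qed

text \<open>In terms of weights, the monomials of weight at least \<open>w * d - 2 * L\<close>;
  hence an up-closed set.\<close>

definition cheap :: "nat \<Rightarrow> nat \<Rightarrow> nat \<Rightarrow> 3 monom set"
  where "cheap d w L = {m \<in> Delta d. 2 * lookup m 2 + w * lookup m 3 \<le> 2 * L}"

lemma cheap_upward:
  assumes "w \<ge> 2" "t \<in> cheap d w L" "s \<in> Delta d" "(t, s) \<in> weight_order w"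
  shows "s \<in> cheap d w L"
proof -
  have "weight w t \<le> weight w s"
    using assms(4) by (auto simp: weight_order_def)
  then show ?thesis
    using assms(2,3) weight_Delta[OF assms(1), of t d] weight_Delta[OF assms(1,3)]
    by (auto simp: cheap_def)
qed

definition monom3 :: "nat \<Rightarrow> nat \<Rightarrow> nat \<Rightarrow> 3 monom"
  where "monom3 a b c = single 1 a + single 2 b + single 3 c"

lemma lookup_monom3 [simp]:
  "lookup (monom3 a b c) 1 = a" "lookup (monom3 a b c) 2 = b" "lookup (monom3 a b c) 3 = c"
  by (simp_all add: monom3_def lookup_add lookup_single)

text \<open>The weight is chosen so that the cheap monomials are those with \<open>c = 0, b \<le> L\<close> and those with
  \<open>c = 1, b < d - L\<close>; the condition \<open>2d \<le> 3L\<close> excludes \<open>c = 2\<close>.\<close>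

lemma card_cheap:
  assumes "2 * d \<le> 3 * L" "L \<le> d" "w = 4 * L + 1 - 2 * d"
  shows "card (cheap d w L) = d + 1"
proof -
  let ?A = "(\<lambda>b. monom3 (d - b) b 0) ` {..L}" and ?B = "(\<lambda>b. monom3 (d - 1 - b) b 1) ` {..<d - L}"
  have w: "w + 2 * d = 4 * L + 1"
    using assms by linarith
  have "cheap d w L = ?A \<union> ?B"
  proof (intro set_eqI iffI)
    fix m assume m: "m \<in> cheap d w L"
    then have deg: "lookup m 1 + lookup m 2 + lookup m 3 = d"
      and cost: "2 * lookup m 2 + w * lookup m 3 \<le> 2 * L"
      by (auto simp: cheap_def Delta_def)
    consider "lookup m 3 = 0" | "lookup m 3 = 1" | "lookup m 3 \<ge> 2" by linarith
    then show "m \<in> ?A \<union> ?B"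
    proof cases
      case 1
      then have "m = monom3 (d - lookup m 2) (lookup m 2) 0"
        using deg by (intro monom3_eqI) auto
      then show ?thesis using 1 cost by auto
    next
      case 2
      then have "m = monom3 (d - 1 - lookup m 2) (lookup m 2) 1"
        using deg by (intro monom3_eqI) auto
      \<comment> \<open>The bound reads \<open>2 * b + 1 \<le> 2 * (d - L)\<close>, so
        \<open>b = d - L\<close> is excluded by parity.\<close>
      moreover have "lookup m 2 < d - L"
        using 2 cost w by simp
      ultimately show ?thesis by auto
    next
      case 3
      \<comment> \<open>This would force \<open>w \<le> L\<close>, but
        \<open>w = 4 * L + 1 - 2 * d\<close> is at least \<open>L + 1\<close>.\<close>
      then have "w * 2 \<le> w * lookup m 3" by simp
      then show ?thesis using cost w assms(1) by linarith
    qed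
  next
    fix m assume "m \<in> ?A \<union> ?B"
    then show "m \<in> cheap d w L"
      using assms(1,2) w by (auto simp: cheap_def Delta_def)
  qed
  moreover have "card ?A = L + 1"
    by (subst card_image) (auto intro!: inj_onI dest: arg_cong[where f = "\<lambda>m. lookup m 2"])
  moreover have "card ?B = d - L"
    by (subst card_image) (auto intro!: inj_onI dest: arg_cong[where f = "\<lambda>m. lookup m 2"])
  moreover have "?A \<inter> ?B = {}"
    by (auto dest: arg_cong[where f = "\<lambda>m. lookup m 3"])
  ultimately show ?thesis
    using assms(2) by (simp add: card_Un_disjoint)
qed

text \<open>Two special points are used: one whose forms enumerate the cheap monomials, for degree
  \<open>d\<close>, and one with pure powers, for degree \<open>3 * d\<close>. The two open
  conditions hold together at general \<open>q\<close>.\<close>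

lemma generic_gin_cheap:
  assumes "d \<ge> 2" "2 * d \<le> 3 * L" "L \<le> d" "w = 4 * L + 1 - 2 * d"
  shows "\<exists>f. regular_nz ({1..d + 1} \<times> Delta d) f \<and> (\<forall>q. f q \<noteq> (0 :: 'k::field_char_0) \<longrightarrow>
    (\<forall>u\<in>Delta d. single u 1 \<in> gin (weight_order w) (form_ideal d q) \<longleftrightarrow> u \<in> cheap d w L))"
proof -
  let ?r = "weight_order w" and ?X = "{1..d + 1} \<times> Delta d"
  have w: "w \<ge> 2"
    using assms by linarith
  have lin: "linear_order ?r"
    using term_order_weight_order by (simp add: term_order_def)
  have sub: "cheap d w L \<subseteq> Delta d"
    by (auto simp: cheap_def)
  have card: "card (cheap d w L) = d + 1"
    using assms by (intro card_cheap)
  obtain e where e: "bij_betw e {1..d + 1} (cheap d w L)"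
    using finite_same_card_bij[of "{1..d + 1}" "cheap d w L"] card
      finite_subset[OF sub finite_Delta] by auto
  have "u \<in> leads ?r (Delta d) (shifts d d)
      (\<lambda>x. lookup (shifted_form d (monomial_forms d e :: _ \<Rightarrow> 'k) x))" if u: "u \<in> cheap d w L" for u
  proof -
    obtain i where i: "i \<in> {1..d + 1}" "e i = u"
      using e u by (metis bij_betw_imp_surj_on imageE)
    then have "e i \<in> Delta d"
      using u sub by blast
    then show ?thesis
      using monomial_forms_leads[OF lin i(1), of e 0 d] i(2) by simp
  qed
  then obtain f where f: "regular_nz ?X f" "\<And>q. f q \<noteq> (0 :: 'k) \<Longrightarrow>
      cheap d w L \<subseteq> leads ?r (Delta d) (shifts d d) (\<lambda>x. lookup (shifted_form d q x))"
    using generic_shifted_form_leads[OF lin, of "cheap d w L" d d e] cheap_upward[OF w] by blast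
  obtain f' where f': "regular_nz ?X f'" "\<And>q. f' q \<noteq> (0 :: 'k) \<Longrightarrow>
      Delta (3 * d) \<subseteq> leads ?r (Delta (3 * d)) (shifts d (3 * d)) (\<lambda>x. lookup (shifted_form d q x))"
    using generic_shifted_form_leads[OF lin pure_powers_leads[OF lin assms(1)]] by blast
  have "\<forall>u\<in>Delta d. single u 1 \<in> gin ?r (form_ideal d q) \<longleftrightarrow> u \<in> cheap d w L"
    if q: "f q * f' q \<noteq> 0" for q
  proof
    fix u assume u: "u \<in> Delta d"
    have nz: "f q \<noteq> 0" "f' q \<noteq> 0"
      using q by auto
    show "single u 1 \<in> gin ?r (form_ideal d q) \<longleftrightarrow> u \<in> cheap d w L"
      by (rule gin_form_ideal[OF term_order_weight_order f'(2)[OF nz(2)] f(2)[OF nz(1)] _ card u])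
        (rule cheap_upward[OF w])
  qed
  then show ?thesis
    using regular_nz_mult[OF f(1) f'(1)] by (intro exI[of _ "\<lambda>q. f q * f' q"]) blast
qed

theorem theorem2p13:
  fixes d :: nat
  assumes "d \<ge> 3"
  shows "\<exists>U :: (nat \<times> 3 monom \<Rightarrow> 'k::field_char_0) set.
    zariski_open ({1..d + 1} \<times> Delta d) U \<and> U \<noteq> {} \<and>
    (\<forall>q\<in>U. \<exists>F \<subseteq> {gin r (form_ideal d q) | r. term_order r}.
       finite F \<and> real d / 3 \<le> real (card F))"
proof -
  let ?X = "{1..d + 1} \<times> Delta d"
  define Ls where "Ls = {L. 2 * d \<le> 3 * L \<and> L \<le> d}"
  define w where "w L = 4 * L + 1 - 2 * d" for L
  have "\<exists>f. regular_nz ?X f \<and> (\<forall>q. f q \<noteq> (0 :: 'k) \<longrightarrow> (\<forall>u\<in>Delta d.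
      single u 1 \<in> gin (weight_order (w L)) (form_ideal d q) \<longleftrightarrow> u \<in> cheap d (w L) L))" if "L \<in> Ls" for L
    using generic_gin_cheap[of d L "w L"] that assms by (simp add: Ls_def w_def)
  then obtain f where f: "\<And>L. L \<in> Ls \<Longrightarrow> regular_nz ?X (f L)"
    and gin: "\<And>L q u. L \<in> Ls \<Longrightarrow> f L q \<noteq> (0 :: 'k) \<Longrightarrow> u \<in> Delta d \<Longrightarrow>
      single u 1 \<in> gin (weight_order (w L)) (form_ideal d q) \<longleftrightarrow> u \<in> cheap d (w L) L"
    by metis
  define U where "U = {q \<in> ?X \<rightarrow>\<^sub>E UNIV. (\<Prod>L\<in>Ls. f L q) \<noteq> 0}"
  \<comment> \<open>The lower end is \<open>2 * d / 3\<close> rounded up.\<close>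
  have Ls: "Ls = {(2 * d + 2) div 3..d}"
    unfolding Ls_def by auto
  have nz: "regular_nz ?X (\<lambda>q. \<Prod>L\<in>Ls. f L q)"
    by (intro regular_nz_prod f)
  have "zariski_open ?X U"
    unfolding U_def using nz by (intro zariski_open_nonvanishing) (simp add: regular_nz_def)
  moreover have "U \<noteq> {}"
    using nz unfolding U_def regular_nz_def by blast
  moreover have "\<exists>F \<subseteq> {gin r (form_ideal d q) | r. term_order r}. finite F \<and> real d / 3 \<le> real (card F)"
    if q: "q \<in> U" for q
  proof -
    let ?G = "\<lambda>L. gin (weight_order (w L)) (form_ideal d q)"
    have fq: "f L q \<noteq> 0" if "L \<in> Ls" for L
      using q that by (simp add: U_def Ls)
    have neq: "?G L \<noteq> ?G L'" if L: "L \<in> Ls" "L' \<in> Ls" "L < L'" for L L'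
    proof -
      \<comment> \<open>This monomial has \<open>2b + wc = 2 * L'\<close> for every weight
        \<open>w\<close>: exactly at the bound for \<open>L'\<close> and beyond the one for
        \<open>L\<close>.\<close>
      let ?u = "monom3 (d - L') L' 0"
      have u: "?u \<in> Delta d"
        using L(2) by (simp add: Delta_def Ls_def)
      then have "?u \<in> cheap d (w L') L'" "?u \<notin> cheap d (w L) L"
        using L(3) by (simp_all add: cheap_def)
      then show ?thesis
        using gin[OF L(1) fq[OF L(1)] u] gin[OF L(2) fq[OF L(2)] u] by auto
    qed
    have "inj_on ?G Ls"
      using neq by (intro inj_onI) (metis linorder_neqE_nat)
    then have "card (?G ` Ls) = d + 1 - (2 * d + 2) div 3"
      by (simp add: card_image Ls)
    \<comment> \<open>The number of values of \<open>L\<close> is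
      \<open>d div 3 + 1\<close>.\<close>
    moreover have "d \<le> 3 * (d + 1 - (2 * d + 2) div 3)"
      by linarith
    ultimately have "real d / 3 \<le> real (card (?G ` Ls))"
      by linarith
    moreover have "?G ` Ls \<subseteq> {gin r (form_ideal d q) | r. term_order r}"
      using term_order_weight_order by blast
    moreover have "finite (?G ` Ls)"
      by (simp add: Ls)
    ultimately show ?thesis by blast
  qed
  ultimately show ?thesis by blast
qed

end
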